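(* Let $0<\alpha<1/4$ be a constant and let $d=d(n)$ satisfy $n^{1/2+\alpha}<d<n^{1-\alpha}$. Let $G_{n,d}$ be a uniformly random $d$-regular graph on $n$ labeled vertices. Then asymptotically almost surely (i.e. with probability tending to $1$ as $n\to\infty$), $$m(G_{n,d}) \le \chi(G_{n,d}).$$
   Context: $\chi$ denotes chromatic number. A graph homomorphism $\phi:G\to H$ is a map $V(G)\to V(H)$ sending edges to edges; $\mathrm{Hom}(H,G)$ denotes the set of homomorphisms $H\to G$, made into a graph by joining two homomorphisms by an edge when they differ at exactly one vertex. A graph $G$ is $d$-mobile if the graph $\mathrm{Hom}(H,G)$ is connected for every finite simple graph $H$ of maximum degree $d-2$; the mobility $m(G)$ is the largest $d$ for which $G$ is $d$-mobile. *)

theory Defs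
  imports "HOL-Probability.Probability" "Graph_Theory.Pair_Digraph"
begin

text \<open>
  Finite simple graphs are the \<open>pair_graph\<close>s: finite, symmetric, loop-free relations on a vertex
  set. Each undirected edge is present as two opposite arcs, so \<open>out_degree\<close> is the usual degree.
\<close>

definition max_degree :: "'a pair_pre_digraph \<Rightarrow> nat" where
  "max_degree G = Max (out_degree (with_proj G) ` pverts G)"

definition chromatic_number :: "'a pair_pre_digraph \<Rightarrow> nat" where
  "chromatic_number G =
     (LEAST k. \<exists>c \<in> pverts G \<rightarrow> {..<k}. \<forall>(u, v) \<in> parcs G. c u \<noteq> c v)"

text \<open>Homomorphisms are extensional, so that each one is represented by exactly one function.\<close>

definition graph_homs :: "'b pair_pre_digraph \<Rightarrow> 'a pair_pre_digraph \<Rightarrow> ('b \<Rightarrow> 'a) set" where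
  "graph_homs H G =
     {\<phi> \<in> pverts H \<rightarrow>\<^sub>E pverts G. \<forall>(u, v) \<in> parcs H. (\<phi> u, \<phi> v) \<in> parcs G}"

definition Hom_graph ::
    "'b pair_pre_digraph \<Rightarrow> 'a pair_pre_digraph \<Rightarrow> ('b \<Rightarrow> 'a) pair_pre_digraph" where
  "Hom_graph H G =
     \<lparr> pverts = graph_homs H G,
       parcs = {(\<phi>, \<psi>). \<phi> \<in> graph_homs H G \<and> \<psi> \<in> graph_homs H G \<and>
                        (\<exists>!v. v \<in> pverts H \<and> \<phi> v \<noteq> \<psi> v)} \<rparr>"

text \<open>
  Any two vertices are joined by a path. Unlike the \<open>connected\<close> of \<open>Graph_Theory\<close>, this counts the
  graph without vertices as connected. Otherwise a graph \<open>G\<close> with no clique on \<open>d - 1\<close> vertices would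
  fail to be \<open>d\<close>-mobile merely because there is no homomorphism from that clique to \<open>G\<close>.
\<close>

definition path_connected_graph :: "'a pair_pre_digraph \<Rightarrow> bool" where
  "path_connected_graph G \<longleftrightarrow> (\<forall>u \<in> pverts G. \<forall>v \<in> pverts G. u \<rightarrow>\<^sup>*\<^bsub>with_proj G\<^esub> v)"

text \<open>
  Every finite graph is isomorphic to one whose vertices are natural numbers, so it suffices to let
  \<open>H\<close> range over those. The maximum degree is exactly \<open>d - 2\<close>, with no truncated subtraction.
\<close>

definition mobile :: "nat \<Rightarrow> 'a pair_pre_digraph \<Rightarrow> bool" where
  "mobile d G \<longleftrightarrow>
     (\<forall>H :: nat pair_pre_digraph.
        pair_graph H \<and> pverts H \<noteq> {} \<and> max_degree H + 2 = d \<longrightarrow>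
        path_connected_graph (Hom_graph H G))"

text \<open>
  The set of these \<open>d\<close> contains 0, so its supremum is its largest element if there is one; the
  supremum is \<open>\<infinity>\<close> if \<open>G\<close> is \<open>d\<close>-mobile for arbitrarily large \<open>d\<close>.
\<close>

definition mobility :: "'a pair_pre_digraph \<Rightarrow> enat" where
  "mobility G = Sup {enat d | d. mobile d G}"

definition regular_graphs :: "nat \<Rightarrow> nat \<Rightarrow> nat pair_pre_digraph set" where
  "regular_graphs n d =
     {G. pair_graph G \<and> pverts G = {..<n} \<and> (\<forall>v \<in> pverts G. out_degree (with_proj G) v = d)}"

lemma finite_regular_graphs: "finite (regular_graphs n d)"
proof (rule finite_subset)
  show "regular_graphs n d \<subseteq>
    (\<lambda>E. \<lparr> pverts = {..<n}, parcs = E \<rparr>) ` Pow ({..<n} \<times> {..<n})"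
  proof
    fix G assume G: "G \<in> regular_graphs n d"
    then interpret pair_graph G by (simp add: regular_graphs_def)
    have "parcs G \<in> Pow ({..<n} \<times> {..<n})"
      using G in_arcsD1 in_arcsD2 by (auto simp: regular_graphs_def)
    moreover have "G = \<lparr> pverts = {..<n}, parcs = parcs G \<rparr>"
      using G by (simp add: regular_graphs_def)
    ultimately show "G \<in> (\<lambda>E. \<lparr> pverts = {..<n}, parcs = E \<rparr>) ` Pow ({..<n} \<times> {..<n})"
      by blast
  qed
qed auto

text \<open>Meaningful only when a \<open>d\<close>-regular graph exists, that is, if \<open>d < n\<close> and \<open>n * d\<close> is even.\<close>

definition random_regular_graph :: "nat \<Rightarrow> nat \<Rightarrow> nat pair_pre_digraph pmf" where
  "random_regular_graph n d = pmf_of_set (regular_graphs n d)"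

text \<open>The limit is taken along those \<open>n\<close> for which \<open>d n\<close>-regular graphs on \<open>n\<close> vertices can exist.\<close>

definition asymp_almost_surely_regular ::
    "(nat \<Rightarrow> nat) \<Rightarrow> (nat pair_pre_digraph \<Rightarrow> bool) \<Rightarrow> bool" where
  "asymp_almost_surely_regular d P \<longleftrightarrow>
     ((\<lambda>n. measure_pmf.prob (random_regular_graph n (d n)) {G. P G}) \<longlongrightarrow> 1)
       (inf sequentially (principal {n. even (n * d n)}))"

end

theory Submission
  imports Defs "HOL-Real_Asymp.Real_Asymp"
begin

text \<open>
  Switching two edges shows that, conditionally on a small set of other edges, a given edge lies in
  the random regular graph with probability at most \<open>(1 + o(1)) * d / n\<close>. High moments of the
  codegrees then show that all codegrees are at most \<open>(1 + n powr (- \<alpha> / 2)) * d\<^sup>2 / n\<close> with high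
  probability, and the rest is deterministic. By Cauchy-Schwarz, small codegrees force independent
  sets to be small and hence the chromatic number to be at least \<open>n powr (\<alpha> / 2) / 2\<close>. On the other
  hand, since no two neighbourhoods are nearly equal, logarithmically many matchings suffice to pin
  down each vertex as the only common neighbour of its partners. Their union has logarithmic maximum
  degree, and its bipartite double cover has a frozen homomorphism to \<open>G\<close>, the projection, as well as
  the homomorphisms onto a single edge. So mobility fails as soon as the maximum degree allowed for
  \<open>H\<close> is at least logarithmic.
\<close>

section \<open>Switchings in regular graphs\<close>

text \<open>The vertex set is always \<open>{..<n}\<close>, so regular graphs are counted through
  their arc sets, in which an undirected edge is two opposite pairs.
  \<open>regular_graphs_eq_image\<close> translates back.\<close>

definition regular_rels :: "nat \<Rightarrow> nat \<Rightarrow> nat rel set" where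
  "regular_rels n d =
     {E. E \<subseteq> {..<n} \<times> {..<n} \<and> sym E \<and> irrefl E \<and> (\<forall>v<n. card (E `` {v}) = d)}"

lemma finite_regular_rels: "finite (regular_rels n d)"
  by (rule finite_subset[of _ "Pow ({..<n} \<times> {..<n})"]) (auto simp: regular_rels_def)

lemma finite_regular_rel: "E \<in> regular_rels n d \<Longrightarrow> finite E"
  by (rule finite_subset[of _ "{..<n} \<times> {..<n}"]) (auto simp: regular_rels_def)

lemma regular_rel_Image_subset: "E \<in> regular_rels n d \<Longrightarrow> E `` A \<subseteq> {..<n}"
  by (auto simp: regular_rels_def)

lemma finite_regular_rel_Image: "E \<in> regular_rels n d \<Longrightarrow> finite (E `` A)"
  by (rule finite_subset[OF regular_rel_Image_subset finite_lessThan])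

lemma card_regular_rel_Image_le: "E \<in> regular_rels n d \<Longrightarrow> card (E `` {v}) \<le> d"
proof (cases "v < n")
  case False
  assume "E \<in> regular_rels n d"
  then have "E `` {v} = {}" using False by (auto simp: regular_rels_def)
  then show ?thesis by simp
qed (simp add: regular_rels_def)

lemma card_out_arcs_from:
  assumes E: "E \<in> regular_rels n d" and A: "A \<subseteq> {..<n}"
  shows "card {(x, y) \<in> E. x \<in> A} = card A * d"
proof -
  have fin: "finite A" using A finite_subset by blast
  have "{(x, y) \<in> E. x \<in> A} = Sigma A (\<lambda>x. E `` {x})" by auto
  also have "card \<dots> = (\<Sum>x\<in>A. card (E `` {x}))"
    using fin finite_regular_rel_Image[OF E] by (intro card_SigmaI) auto
  also have "\<dots> = (\<Sum>x\<in>A. d)"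
    using E A by (intro sum.cong) (auto simp: regular_rels_def)
  finally show ?thesis by simp
qed

lemma card_in_arcs_to:
  assumes E: "E \<in> regular_rels n d" and A: "A \<subseteq> {..<n}"
  shows "card {(x, y) \<in> E. y \<in> A} = card A * d"
proof -
  have "bij_betw prod.swap {(x, y) \<in> E. y \<in> A} {(x, y) \<in> E. x \<in> A}"
    using E by (auto simp: regular_rels_def bij_betw_def inj_on_def image_iff dest: symD)
  from bij_betw_same_card[OF this] show ?thesis using card_out_arcs_from[OF E A] by simp
qed

lemma card_regular_rel: "E \<in> regular_rels n d \<Longrightarrow> card E = n * d"
proof -
  assume E: "E \<in> regular_rels n d"
  then have "{(x, y) \<in> E. x \<in> {..<n}} = E" by (auto simp: regular_rels_def)
  with card_out_arcs_from[OF E order_refl] show ?thesis by (simp only: card_lessThan)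
qed

text \<open>The classical edge switching on the closed walk u, v, y, x, meant for walks that
  alternate between edges and non-edges.\<close>

definition switch :: "'a \<Rightarrow> 'a \<Rightarrow> 'a \<Rightarrow> 'a \<Rightarrow> 'a rel \<Rightarrow> 'a rel" where
  "switch u v x y E = (E - {(u, v), (v, u), (x, y), (y, x)}) \<union> {(u, x), (x, u), (v, y), (y, v)}"

text \<open>The arcs that can be switched with uv without creating a loop or a double edge.
  \<open>F\<close> holds the arcs that have to survive the switching.\<close>

definition switch_arcs :: "'a \<Rightarrow> 'a \<Rightarrow> 'a rel \<Rightarrow> 'a rel \<Rightarrow> 'a rel" where
  "switch_arcs u v F E =
     {(x, y) \<in> E - F. x \<notin> insert u (E `` {u}) \<and> y \<notin> insert v (E `` {v})}"

text \<open>The excluded arcs start in the closed neighbourhood of u, end in that of v, or lie in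
  \<open>F\<close>. A closed neighbourhood has at most d + 1 vertices, each with d arcs.\<close>

lemma card_switch_arcs:
  assumes E: "E \<in> regular_rels n d" and "(u, v) \<in> E" and F: "finite F"
  shows "n * d - 2 * d * (d + 1) - card F \<le> card (switch_arcs u v F E)"
proof -
  have uv: "u < n" "v < n" using assms by (auto simp: regular_rels_def)
  define A where "A w = insert w (E `` {w})" for w
  have A: "A w \<subseteq> {..<n} \<and> card (A w) \<le> d + 1" if "w < n" for w
    using that E card_insert_le_m1[of "d + 1" "E `` {w}" w]
    by (auto simp: A_def regular_rels_def)
  define X where "X = {(x, y) \<in> E. x \<in> A u} \<union> {(x, y) \<in> E. y \<in> A v}"
  have "card X \<le> card (A u) * d + card (A v) * d"
    unfolding X_def using A uv card_out_arcs_from[OF E, of "A u"] card_in_arcs_to[OF E, of "A v"]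
    by (intro order.trans[OF card_Un_le]) auto
  also have "\<dots> \<le> (d + 1) * d + (d + 1) * d"
    using A uv by (intro add_mono mult_right_mono) auto
  finally have X: "card X \<le> 2 * d * (d + 1)" by (simp add: algebra_simps)
  have "switch_arcs u v F E = E - X - F"
    by (auto simp: switch_arcs_def X_def A_def)
  moreover have "card E - card X - card F \<le> card (E - X - F)"
  proof -
    have "finite X"
      using finite_regular_rel[OF E] by (auto simp: X_def intro: finite_subset[of _ E])
    from diff_card_le_card_Diff[OF this, of E] diff_card_le_card_Diff[OF F, of "E - X"]
    show ?thesis by linarith
  qed
  ultimately show ?thesis using X card_regular_rel[OF E] by auto
qed

text \<open>The conditions on x and y force the four vertices to be distinct. Each of them then
  exchanges one neighbour for a former non-neighbour.\<close>

lemma switch_regular: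
  assumes E: "E \<in> regular_rels n d" and "(u, v) \<in> E" and "(x, y) \<in> switch_arcs u v F E"
  shows "switch u v x y E \<in> regular_rels n d"
proof -
  have sym: "sym E" and irr: "irrefl E" and sub: "E \<subseteq> {..<n} \<times> {..<n}"
    and deg: "\<And>w. w < n \<Longrightarrow> card (E `` {w}) = d"
    using E by (auto simp: regular_rels_def)
  have xy: "(x, y) \<in> E" "(u, x) \<notin> E" "(v, y) \<notin> E" "x \<noteq> u" "y \<noteq> v"
    using assms(3) by (auto simp: switch_arcs_def)
  have yx: "(y, x) \<in> E" "(x, u) \<notin> E" "(y, v) \<notin> E" "(v, u) \<in> E"
    using xy sym assms(2) by (auto dest: symD)
  have ne: "u \<noteq> v" "x \<noteq> y" "x \<noteq> v" "y \<noteq> u"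
    using xy yx assms(2) irr by (auto simp: irrefl_def)
  let ?E = "switch u v x y E"
  have swap: "card (insert b (E `` {w} - {a})) = d" if "(w, a) \<in> E" "(w, b) \<notin> E" for w a b
  proof -
    have "w < n" using that sub by auto
    then have "card (E `` {w}) = d" using deg by auto
    moreover have "card (E `` {w}) > 0"
      using that finite_regular_rel_Image[OF E] by (auto simp: card_gt_0_iff)
    ultimately show ?thesis
      using that finite_regular_rel_Image[OF E, of "{w}"] by (simp add: card_insert_if)
  qed
  have "card (?E `` {w}) = d" if "w < n" for w
  proof -
    consider "w = u" | "w = v" | "w = x" | "w = y" | "w \<notin> {u, v, x, y}" by blast
    then show ?thesis
    proof cases
      case 1
      then have "?E `` {w} = insert x (E `` {u} - {v})"
        using ne xy by (auto simp: switch_def)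
      then show ?thesis using swap[OF assms(2) xy(2)] by simp
    next
      case 2
      then have "?E `` {w} = insert y (E `` {v} - {u})"
        using ne xy by (auto simp: switch_def)
      then show ?thesis using swap[OF yx(4) xy(3)] by simp
    next
      case 3
      then have "?E `` {w} = insert u (E `` {x} - {y})"
        using ne xy by (auto simp: switch_def)
      then show ?thesis using swap[OF xy(1) yx(2)] by simp
    next
      case 4
      then have "?E `` {w} = insert v (E `` {y} - {x})"
        using ne xy by (auto simp: switch_def)
      then show ?thesis using swap[OF yx(1) yx(3)] by simp
    next
      case 5
      then have "?E `` {w} = E `` {w}" by (auto simp: switch_def)
      then show ?thesis using deg that by simp
    qed
  qed
  moreover have "?E \<subseteq> {..<n} \<times> {..<n}" using sub xy assms(2) by (auto simp: switch_def)
  moreover have "sym ?E"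
    by (rule symI) (use symD[OF sym] in \<open>unfold switch_def, simp, metis\<close>)
  moreover have "irrefl ?E" using irr xy by (auto simp: switch_def irrefl_def)
  ultimately show ?thesis by (simp add: regular_rels_def)
qed

text \<open>All removed pairs were in \<open>E\<close> and all inserted ones were not, so the
  switched relation together with the four vertices determines \<open>E\<close>. This makes
  switching injective.\<close>

lemma switch_undo:
  assumes "sym E" "(u, v) \<in> E" "(x, y) \<in> switch_arcs u v F E"
  shows "E = (switch u v x y E - {(u, x), (x, u), (v, y), (y, v)})
    \<union> {(u, v), (v, u), (x, y), (y, x)}"
proof -
  have "(x, y) \<in> E" "(u, x) \<notin> E" "(v, y) \<notin> E"
    using assms(3) by (auto simp: switch_arcs_def)
  moreover from this have "(y, x) \<in> E" "(x, u) \<notin> E" "(y, v) \<notin> E" "(v, u) \<in> E"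
    using assms(1,2) by (meson symD)+
  ultimately show ?thesis using assms(2) unfolding switch_def
    by (intro equalityI subsetI) (simp_all, force+)
qed

text \<open>Double counting of switchings. A switching leads to a relation in which x is a neighbour
  of u and y a neighbour of v, and such a relation offers at most d^2 choices of x and y. In effect
  this bounds the probability of uv, given the edges in \<open>F\<close>, by about d / n.\<close>

lemma regular_rels_insert_edge:
  assumes F: "finite F" "sym F" and uv: "u \<noteq> v" "(u, v) \<notin> F"
  shows "card {E \<in> regular_rels n d. F \<subseteq> E \<and> (u, v) \<in> E} * (n * d - 2 * d * (d + 1) - card F)
    \<le> card {E \<in> regular_rels n d. F \<subseteq> E} * d\<^sup>2"
proof -
  let ?R = "regular_rels n d"
  define A where "A = {E \<in> ?R. F \<subseteq> E \<and> (u, v) \<in> E}"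
  define B where "B = {E \<in> ?R. F \<subseteq> E}"
  have fin: "finite A" "finite B" using finite_regular_rels by (auto simp: A_def B_def)
  define P where "P = Sigma A (switch_arcs u v F)"
  define Q where "Q = Sigma B (\<lambda>E. E `` {u} \<times> E `` {v})"
  have finP: "finite (switch_arcs u v F E)" if "E \<in> A" for E
    using that finite_regular_rel by (auto simp: A_def switch_arcs_def intro: finite_subset[of _ E])
  have "card A * (n * d - 2 * d * (d + 1) - card F)
      = (\<Sum>E\<in>A. n * d - 2 * d * (d + 1) - card F)" by simp
  also have "\<dots> \<le> (\<Sum>E\<in>A. card (switch_arcs u v F E))"
    using card_switch_arcs F by (intro sum_mono) (auto simp: A_def)
  also have "\<dots> = card P"
    using fin finP by (simp add: P_def card_SigmaI)
  also have "\<dots> \<le> card Q"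
  proof (rule card_inj_on_le)
    let ?f = "\<lambda>(E, x, y). (switch u v x y E, x, y)"
    show "inj_on ?f P"
    proof (rule inj_onI, clarsimp simp: P_def)
      fix E x y E'
      assume *: "E \<in> A" "(x, y) \<in> switch_arcs u v F E" "E' \<in> A" "(x, y) \<in> switch_arcs u v F E'"
        "switch u v x y E = switch u v x y E'"
      show "E = E'"
        using switch_undo[OF _ _ *(2)] switch_undo[OF _ _ *(4)] *(1,3,5)
        by (simp add: A_def regular_rels_def)
    qed
    show "?f ` P \<subseteq> Q"
    proof (clarsimp simp: P_def Q_def, intro conjI)
      fix E x y assume E: "E \<in> A" and xy: "(x, y) \<in> switch_arcs u v F E"
      \<comment> \<open>Neither (u, v) nor (x, y) lies in the symmetric relation \<open>F\<close>,
        so no removed pair does.\<close>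
      have "F \<subseteq> switch u v x y E"
        using E xy uv F(2) by (auto simp: A_def switch_arcs_def switch_def dest: symD)
      then show "switch u v x y E \<in> B"
        using E xy switch_regular by (auto simp: A_def B_def)
    qed (auto simp: switch_def)
    show "finite Q"
      using fin finite_regular_rel_Image by (auto simp: Q_def B_def)
  qed
  also have "card Q = (\<Sum>E\<in>B. card (E `` {u}) * card (E `` {v}))"
    unfolding Q_def using fin finite_regular_rel_Image
    by (subst card_SigmaI) (auto simp: B_def card_cartesian_product)
  also have "\<dots> \<le> (\<Sum>E\<in>B. d * d)"
    using card_regular_rel_Image_le by (intro sum_mono mult_mono) (auto simp: B_def)
  finally show ?thesis by (simp add: A_def B_def power2_eq_square)
qed

section \<open>Moments and tails of the codegrees\<close>

text \<open>Every x in \<open>R\<close> imposes the two edges ux and vx, and each of them costs a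
  factor d^2 / s by \<open>regular_rels_insert_edge\<close>. A vertex of \<open>R\<close> accounts
  for at most four arcs, so subtracting 4 * r makes the same s valid throughout the
  induction.\<close>

lemma regular_rels_common_neighbours:
  assumes uv: "u \<noteq> v" and R: "finite R" "u \<notin> R" "v \<notin> R" "card R \<le> r"
  shows "card {E \<in> regular_rels n d. R \<subseteq> E `` {u} \<inter> E `` {v}}
      * (n * d - 2 * d * (d + 1) - 4 * r) ^ (2 * card R)
    \<le> card (regular_rels n d) * d ^ (4 * card R)"
  using R
proof (induction R rule: finite_induct)
  case empty
  then show ?case by simp
next
  case (insert x R)
  let ?Q = "regular_rels n d"
  define s where "s = n * d - 2 * d * (d + 1) - 4 * r"
  define F where "F = (\<Union>y\<in>R. {(u, y), (y, u), (v, y), (y, v)})"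
  define F' where "F' = F \<union> {(u, x), (x, u)}"
  define a where "a = card {E \<in> ?Q. R \<subseteq> E `` {u} \<inter> E `` {v}}"
  define a1 where "a1 = card {E \<in> ?Q. F' \<subseteq> E}"
  define a2 where "a2 = card {E \<in> ?Q. insert x R \<subseteq> E `` {u} \<inter> E `` {v}}"
  have F: "finite F" "sym F" "finite F'" "sym F'"
    using insert.hyps by (auto simp: F_def F'_def sym_def)
  have four: "card {(u, y), (y, u), (v, y), (y, v)} \<le> 4" for y
    by (rule order.trans[OF card_insert_le_m1]) (auto intro!: card_insert_le_m1)
  have "card F \<le> (\<Sum>y\<in>R. card {(u, y), (y, u), (v, y), (y, v)})"
    unfolding F_def by (rule card_UN_le) (fact insert.hyps)
  also have "\<dots> \<le> card R * 4"
    using four by (intro sum_bounded_above[THEN order.trans]) auto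
  finally have cF: "card F \<le> 4 * card R" by simp
  have "card F' \<le> card F + card {(u, x), (x, u)}"
    unfolding F'_def by (rule card_Un_le)
  also have "card {(u, x), (x, u)} \<le> 2" by (intro card_insert_le_m1) auto
  finally have cF': "card F' \<le> 4 * card R + 2" using cF by simp
  have r: "card R + 1 \<le> r" using insert.prems insert.hyps by simp
  have ne: "(u, x) \<notin> F" "(v, x) \<notin> F'" "u \<noteq> x" "v \<noteq> x"
    using insert.hyps insert.prems uv by (auto simp: F_def F'_def)
  have symE: "sym E" if "E \<in> ?Q" for E using that by (simp add: regular_rels_def)
  have eqF: "F \<subseteq> E \<longleftrightarrow> R \<subseteq> E `` {u} \<inter> E `` {v}" if "E \<in> ?Q" for E
    using symE[OF that] by (auto simp: F_def dest: symD)
  have e0: "{E \<in> ?Q. F \<subseteq> E} = {E \<in> ?Q. R \<subseteq> E `` {u} \<inter> E `` {v}}"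
    using eqF by blast
  have e1: "{E \<in> ?Q. F \<subseteq> E \<and> (u, x) \<in> E} = {E \<in> ?Q. F' \<subseteq> E}"
    using symE by (auto simp: F'_def dest: symD)
  have e2: "{E \<in> ?Q. F' \<subseteq> E \<and> (v, x) \<in> E} = {E \<in> ?Q. insert x R \<subseteq> E `` {u} \<inter> E `` {v}}"
    using eqF by (auto simp: F'_def dest: symD[OF symE])
  have "a1 * s \<le> a1 * (n * d - 2 * d * (d + 1) - card F)"
    using cF r by (intro mult_left_mono) (auto simp: s_def)
  also have "\<dots> \<le> a * d\<^sup>2"
    using regular_rels_insert_edge[OF F(1,2) ne(3,1), of n d] by (simp add: a_def a1_def e0 e1)
  finally have 1: "a1 * s \<le> a * d\<^sup>2" .
  have "a2 * s \<le> a2 * (n * d - 2 * d * (d + 1) - card F')"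
    using cF' r by (intro mult_left_mono) (auto simp: s_def)
  also have "\<dots> \<le> a1 * d\<^sup>2"
    using regular_rels_insert_edge[OF F(3,4) ne(4,2), of n d] by (simp add: a2_def a1_def e2)
  finally have 2: "a2 * s \<le> a1 * d\<^sup>2" .
  have 3: "a * s ^ (2 * card R) \<le> card ?Q * d ^ (4 * card R)"
    using insert.IH insert.prems r by (simp add: a_def s_def)
  have "a2 * s ^ (2 * card R + 2) = a2 * s * s * s ^ (2 * card R)"
    by (simp add: power_add power2_eq_square)
  also have "\<dots> \<le> a1 * d\<^sup>2 * s * s ^ (2 * card R)"
    using 2 by (intro mult_right_mono) auto
  also have "\<dots> = a1 * s * d\<^sup>2 * s ^ (2 * card R)" by simp
  also have "\<dots> \<le> a * d\<^sup>2 * d\<^sup>2 * s ^ (2 * card R)"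
    using 1 by (intro mult_right_mono) auto
  also have "\<dots> = a * s ^ (2 * card R) * d ^ 4" by (simp add: power2_eq_square power4_eq_xxxx)
  also have "\<dots> \<le> card ?Q * d ^ (4 * card R) * d ^ 4"
    using 3 by (intro mult_right_mono) auto
  finally show ?case
    using insert.hyps by (simp add: a2_def s_def power_add algebra_simps)
qed

text \<open>The quotient of the two binomial coefficients is a product of r factors (n - i) / (t -
  i), each compared with n / (t - r). Denominators are cleared to stay within the naturals.\<close>

lemma binomial_ratio_le:
  fixes n t r :: nat
  assumes "r \<le> t"
  shows "(n choose r) * (t - r) ^ r \<le> (t choose r) * n ^ r"
  using assms
proof (induction r)
  case (Suc r)
  have absorb: "Suc r * (m choose Suc r) = (m - r) * (m choose r)" for m
    using binomial_absorb_comp[of m r] times_binomial_minus1_eq[of "Suc r" m] by simp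
  have "Suc r * ((n choose Suc r) * (t - Suc r) ^ Suc r)
      = Suc r * (n choose Suc r) * (t - Suc r) ^ Suc r" by (simp only: mult.assoc)
  also have "\<dots> = (n - r) * (t - Suc r) * ((n choose r) * (t - Suc r) ^ r)"
    by (simp only: absorb power_Suc mult_ac)
  also have "\<dots> \<le> n * (t - r) * ((n choose r) * (t - r) ^ r)"
    by (intro mult_mono power_mono) auto
  also have "\<dots> \<le> n * (t - r) * ((t choose r) * n ^ r)"
    using Suc by (intro mult_left_mono) auto
  also have "\<dots> = (t - r) * (t choose r) * n ^ Suc r"
    by (simp only: power_Suc mult_ac)
  also have "\<dots> = Suc r * ((t choose Suc r) * n ^ Suc r)"
    by (simp only: absorb[symmetric] mult.assoc)
  finally show ?case by (simp only: mult_le_cancel1)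
qed simp

text \<open>The binomial coefficient counts the r-sets of common neighbours of u and v. Exchanging
  the sums reduces this r-th binomial moment to the count for one fixed set.\<close>

lemma sum_codegree_choose_le:
  assumes "u \<noteq> v"
  shows "(\<Sum>E\<in>regular_rels n d. card (E `` {u} \<inter> E `` {v}) choose r)
      * (n * d - 2 * d * (d + 1) - 4 * r) ^ (2 * r)
    \<le> (n choose r) * (card (regular_rels n d) * d ^ (4 * r))"
proof -
  let ?Q = "regular_rels n d"
  define s where "s = n * d - 2 * d * (d + 1) - 4 * r"
  define T where "T = {R. R \<subseteq> {..<n} \<and> card R = r}"
  have finT: "finite T" by (simp add: T_def)
  have cardT: "card T = n choose r" using n_subsets[of "{..<n}" r] by (simp add: T_def)
  define N where "N = (\<lambda>E::nat rel. E `` {u} \<inter> E `` {v})"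
  have "(card (N E) choose r) = card {R \<in> T. R \<subseteq> N E}" if "E \<in> ?Q" for E
  proof -
    have "finite (N E)" "N E \<subseteq> {..<n}"
      using finite_regular_rel_Image[OF that] regular_rel_Image_subset[OF that]
      by (auto simp: N_def)
    then have "{R \<in> T. R \<subseteq> N E} = {R. R \<subseteq> N E \<and> card R = r}" by (auto simp: T_def)
    then show ?thesis using n_subsets[OF \<open>finite (N E)\<close>] by simp
  qed
  then have "(\<Sum>E\<in>?Q. card (N E) choose r) = (\<Sum>E\<in>?Q. card {R \<in> T. R \<subseteq> N E})"
    by (rule sum.cong[OF refl])
  also have "\<dots> = (\<Sum>R\<in>T. card {E \<in> ?Q. R \<subseteq> N E})"
    by (rule sum_multicount_gen) (use finite_regular_rels finT in auto)
  finally have "(\<Sum>E\<in>?Q. card (N E) choose r) * s ^ (2 * r)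
      = (\<Sum>R\<in>T. card {E \<in> ?Q. R \<subseteq> N E} * s ^ (2 * r))"
    by (simp add: sum_distrib_right)
  also have "\<dots> \<le> (\<Sum>R\<in>T. card ?Q * d ^ (4 * r))"
  proof (rule sum_mono)
    fix R assume R: "R \<in> T"
    show "card {E \<in> ?Q. R \<subseteq> N E} * s ^ (2 * r) \<le> card ?Q * d ^ (4 * r)"
    proof (cases "u \<in> R \<or> v \<in> R")
      \<comment> \<open>A set containing u or v is never a set of common neighbours, since there are
        no loops.\<close>
      case True
      have "u \<notin> N E" "v \<notin> N E" if "E \<in> ?Q" for E
        using that by (auto simp: N_def regular_rels_def irrefl_def)
      then have "{E \<in> ?Q. R \<subseteq> N E} = {}" using True by auto
      then show ?thesis by (simp only:) simp
    next
      case False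
      then show ?thesis
        using R assms regular_rels_common_neighbours[of u v R r n d]
        by (auto simp: T_def N_def s_def intro: finite_subset)
    qed
  qed
  finally show ?thesis by (simp add: cardT N_def s_def)
qed

text \<open>Markov's inequality for the r-th binomial moment, followed by
  \<open>binomial_ratio_le\<close>.\<close>

lemma card_large_codegree_le:
  assumes "u \<noteq> v" and "r \<le> t"
  shows "card {E \<in> regular_rels n d. t \<le> card (E `` {u} \<inter> E `` {v})}
      * ((t - r) * (n * d - 2 * d * (d + 1) - 4 * r)\<^sup>2) ^ r
    \<le> card (regular_rels n d) * (n * d ^ 4) ^ r"
proof -
  let ?Q = "regular_rels n d"
  let ?B = "{E \<in> ?Q. t \<le> card (E `` {u} \<inter> E `` {v})}"
  define s where "s = n * d - 2 * d * (d + 1) - 4 * r"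
  have "card ?B * (t choose r) = (\<Sum>E\<in>?B. t choose r)" by simp
  also have "\<dots> \<le> (\<Sum>E\<in>?B. card (E `` {u} \<inter> E `` {v}) choose r)"
    by (intro sum_mono binomial_right_mono) auto
  also have "\<dots> \<le> (\<Sum>E\<in>?Q. card (E `` {u} \<inter> E `` {v}) choose r)"
    by (intro sum_mono2 finite_regular_rels) auto
  finally have 1: "card ?B * (t choose r) \<le> (\<Sum>E\<in>?Q. card (E `` {u} \<inter> E `` {v}) choose r)" .
  have pos: "(t choose r) > 0" using assms(2) by simp
  have "(t choose r) * (card ?B * ((t - r) * s\<^sup>2) ^ r)
      = card ?B * (t choose r) * s ^ (2 * r) * (t - r) ^ r"
    unfolding power_mult power_mult_distrib by (simp only: mult_ac)
  also have "\<dots> \<le> (\<Sum>E\<in>?Q. card (E `` {u} \<inter> E `` {v}) choose r) * s ^ (2 * r) * (t - r) ^ r"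
    using 1 by (intro mult_right_mono) auto
  also have "\<dots> \<le> (n choose r) * (card ?Q * d ^ (4 * r)) * (t - r) ^ r"
    using sum_codegree_choose_le[OF assms(1), of r n d] by (intro mult_right_mono) (auto simp: s_def)
  also have "\<dots> = (n choose r) * (t - r) ^ r * (card ?Q * d ^ (4 * r))" by simp
  also have "\<dots> \<le> (t choose r) * n ^ r * (card ?Q * d ^ (4 * r))"
    using binomial_ratio_le[OF assms(2), of n] by (intro mult_right_mono) auto
  also have "\<dots> = (t choose r) * (card ?Q * (n * d ^ 4) ^ r)"
    unfolding power_mult power_mult_distrib by (simp only: mult_ac)
  finally show ?thesis using pos by (simp add: s_def)
qed

section \<open>Existence of regular graphs, and passage between graphs and relations\<close>

text \<open>The witness is a circulant graph: every vertex is joined to the h nearest ones on either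
  side of a cycle and, if d is odd, to the antipodal vertex, n being even in that case.\<close>

lemma regular_rels_nonempty:
  assumes "d < n" "even (n * d)"
  shows "regular_rels n d \<noteq> {}"
proof -
  define h where "h = d div 2"
  define S where "S = {1..h} \<union> {n - h..<n} \<union> (if odd d then {n div 2} else {})"
  have h: "2 * h + (if odd d then 1 else 0) = d" by (auto simp: h_def)
  have half: "h < n div 2" "n div 2 < n - h" "2 * (n div 2) = n" if "odd d"
    using that assms h by auto
  have "h < n - h" using assms h by (auto split: if_splits)
  have S0: "S \<subseteq> {1..<n}"
    using \<open>h < n - h\<close> half by (auto simp: S_def split: if_splits)
  have Ssym: "n - s \<in> S" if "s \<in> S" for s
    using that \<open>h < n - h\<close> half by (auto simp: S_def split: if_splits)
  have "card S = d"
  proof (cases "odd d")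
    case True
    have "card S = card ({1..h} \<union> {n - h..<n}) + card {n div 2}"
      unfolding S_def using True half[OF True] by (subst card_Un_disjoint) auto
    also have "card ({1..h} \<union> {n - h..<n}) = card {1..h} + card {n - h..<n}"
      using \<open>h < n - h\<close> by (intro card_Un_disjoint) auto
    finally show ?thesis using h True \<open>h < n - h\<close> by simp
  next
    case False
    have "card S = card {1..h} + card {n - h..<n}"
      unfolding S_def if_not_P[OF False] Un_empty_right
      using \<open>h < n - h\<close> by (intro card_Un_disjoint) auto
    then show ?thesis using h False \<open>h < n - h\<close> by simp
  qed
  define E where "E = {(i, j). i < n \<and> j < n \<and> (i < j \<and> j - i \<in> S \<or> j < i \<and> i - j \<in> S)}"
  have "card (E `` {i}) = d" if i: "i < n" for i
  proof -
    \<comment> \<open>This is i + s modulo n. After wrapping around, the difference to i is n - s,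
      which is in \<open>S\<close> as well.\<close>
    define g where "g s = (if i + s < n then i + s else i + s - n)" for s
    have "bij_betw g S (E `` {i})"
      unfolding bij_betw_def
    proof
      show "inj_on g S"
        using S0 i by (auto simp: inj_on_def g_def subset_iff split: if_splits)
      show "g ` S = E `` {i}"
      proof (intro equalityI subsetI)
        fix j assume "j \<in> g ` S"
        then obtain s where s: "s \<in> S" "j = g s" by auto
        then have "1 \<le> s" "s < n" using S0 by auto
        show "j \<in> E `` {i}"
        proof (cases "i + s < n")
          case True
          then show ?thesis using s \<open>1 \<le> s\<close> i by (auto simp: E_def g_def)
        next
          case False
          then have "i - j = n - s" "j < i" using s \<open>s < n\<close> i by (auto simp: g_def)
          then show ?thesis using Ssym[OF s(1)] i by (auto simp: E_def)
        qed
      next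
        fix j assume "j \<in> E `` {i}"
        then have j: "j < n" "i < j \<and> j - i \<in> S \<or> j < i \<and> i - j \<in> S" by (auto simp: E_def)
        from j(2) show "j \<in> g ` S"
        proof
          assume "i < j \<and> j - i \<in> S"
          then show ?thesis using j(1) by (intro image_eqI[of _ _ "j - i"]) (auto simp: g_def)
        next
          assume *: "j < i \<and> i - j \<in> S"
          then have "n - (i - j) \<in> S" using Ssym by blast
          moreover have "j = g (n - (i - j))" using * i by (auto simp: g_def)
          ultimately show ?thesis by blast
        qed
      qed
    qed
    then show ?thesis using bij_betw_same_card \<open>card S = d\<close> by force
  qed
  moreover have "E \<subseteq> {..<n} \<times> {..<n}" "sym E" "irrefl E"
    by (auto simp: E_def sym_def irrefl_def)
  ultimately have "E \<in> regular_rels n d" by (simp add: regular_rels_def)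
  then show ?thesis by blast
qed

lemma out_degree_eq_card_Image: "out_degree (with_proj G) v = card (parcs G `` {v})"
proof -
  have "out_arcs (with_proj G) v = Pair v ` (parcs G `` {v})"
    by (auto simp: out_arcs_def)
  then show ?thesis by (simp add: out_degree_def card_image inj_on_def)
qed

lemma regular_graphs_eq_image:
  "regular_graphs n d = (\<lambda>E. \<lparr> pverts = {..<n}, parcs = E \<rparr>) ` regular_rels n d"
proof (intro equalityI subsetI)
  fix G assume G: "G \<in> regular_graphs n d"
  then interpret pair_graph G by (simp add: regular_graphs_def)
  have "parcs G \<in> regular_rels n d"
    using G in_arcsD1 in_arcsD2 pair_sym_arcs
    by (auto simp: regular_graphs_def regular_rels_def symmetric_def irrefl_def
        out_degree_eq_card_Image dest: no_loops')
  moreover have "G = \<lparr> pverts = {..<n}, parcs = parcs G \<rparr>"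
    using G by (simp add: regular_graphs_def)
  ultimately show "G \<in> (\<lambda>E. \<lparr> pverts = {..<n}, parcs = E \<rparr>) ` regular_rels n d" by blast
next
  fix G assume "G \<in> (\<lambda>E. \<lparr> pverts = {..<n}, parcs = E \<rparr>) ` regular_rels n d"
  then obtain E where E: "E \<in> regular_rels n d" and G: "G = \<lparr> pverts = {..<n}, parcs = E \<rparr>"
    by blast
  have "pair_graph G"
  proof unfold_locales
    show "finite (parcs G)" using finite_regular_rel[OF E] by (simp add: G)
    show "fst e \<in> pverts G" "snd e \<in> pverts G" if "e \<in> parcs G" for e
      using E that by (auto simp: G regular_rels_def)
    show "fst e \<noteq> snd e" if "e \<in> parcs G" for e
      using E that by (cases e) (auto simp: G regular_rels_def irrefl_def)
    show "symmetric (with_proj G)" using E by (simp add: G symmetric_def regular_rels_def)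
  qed (simp add: G)
  then show "G \<in> regular_graphs n d"
    using E by (auto simp: G regular_graphs_def regular_rels_def out_degree_eq_card_Image)
qed

section \<open>Matchings that separate neighbourhoods\<close>

text \<open>Greedy colouring: an edge meets at most 2 * (d - 1) others, so one of 2 * d colours is
  free for it. Injectivity of \<open>c u\<close> around every u says that the colour classes are
  matchings.\<close>

lemma proper_edge_colouring_exists:
  fixes E :: "'a rel"
  assumes "finite E" "sym E" "irrefl E" "\<And>v. card (E `` {v}) \<le> d" "0 < d"
  shows "\<exists>c :: 'a \<Rightarrow> 'a \<Rightarrow> nat. (\<forall>(u, v) \<in> E. c u v < 2 * d \<and> c u v = c v u) \<and>
    (\<forall>u. inj_on (c u) (E `` {u}))"
  using assms
proof (induction "card E" arbitrary: E rule: less_induct)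
  case less
  show ?case
  proof (cases "E = {}")
    case True
    then show ?thesis by simp
  next
    case False
    then obtain u v where uv: "(u, v) \<in> E" by auto
    then have vu: "(v, u) \<in> E" and ne: "u \<noteq> v"
      using less.prems by (auto dest: symD simp: irrefl_def)
    define E' where "E' = E - {(u, v), (v, u)}"
    have finI: "finite (E `` A)" for A using less.prems(1) by (rule finite_Image)
    have sub: "E' `` A \<subseteq> E `` A" for A by (auto simp: E'_def)
    have "card E' < card E"
      using less.prems(1) uv by (intro psubset_card_mono) (auto simp: E'_def)
    moreover have "card (E' `` {w}) \<le> d" for w
      using card_mono[OF finI sub] less.prems(4) by (rule order.trans)
    moreover have "sym E'" using less.prems(2) by (auto simp: E'_def sym_def)
    moreover have "finite E'" "irrefl E'" using less.prems by (auto simp: E'_def irrefl_def)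
    ultimately obtain c :: "'a \<Rightarrow> 'a \<Rightarrow> nat"
      where c: "\<And>x y. (x, y) \<in> E' \<Longrightarrow> c x y < 2 * d \<and> c x y = c y x"
        and inj: "\<And>x. inj_on (c x) (E' `` {x})"
      using less.hyps[of E'] less.prems(5) by blast
    \<comment> \<open>The colours already taken at u or v by the remaining edges.\<close>
    define U where "U = c u ` (E' `` {u}) \<union> c v ` (E' `` {v})"
    have small: "card (c x ` (E' `` {x})) \<le> d - 1" if "(x, y) \<in> E" "(x, y) \<notin> E'" for x y
    proof -
      have "card (c x ` (E' `` {x})) \<le> card (E' `` {x})"
        using finite_subset[OF sub finI] by (rule card_image_le)
      also have "\<dots> \<le> card (E `` {x} - {y})"
        using that finI by (intro card_mono) (auto simp: E'_def)
      also have "\<dots> \<le> d - 1"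
        using that finI[of "{x}"] less.prems(4)[of x] by (subst card_Diff_singleton) auto
      finally show ?thesis .
    qed
    have "card U \<le> card (c u ` (E' `` {u})) + card (c v ` (E' `` {v}))"
      unfolding U_def by (rule card_Un_le)
    also have "\<dots> \<le> (d - 1) + (d - 1)"
      by (intro add_mono small[of u v] small[of v u]) (use uv vu in \<open>auto simp: E'_def\<close>)
    also have "\<dots> < card {..<2 * d}" using less.prems(5) by simp
    finally have "\<not> {..<2 * d} \<subseteq> U"
      using card_mono[of U "{..<2 * d}"] finite_subset[OF sub finI] by (auto simp: U_def)
    then obtain k where k: "k < 2 * d" "k \<notin> U" by auto
    define c' where "c' = (\<lambda>x y. if (x, y) = (u, v) \<or> (x, y) = (v, u) then k else c x y)"
    have "\<forall>(x, y) \<in> E. c' x y < 2 * d \<and> c' x y = c' y x"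
      using c k by (auto simp: c'_def E'_def)
    moreover have "inj_on (c' x) (E `` {x})" for x
    proof (rule inj_onI)
      fix y z assume yz: "y \<in> E `` {x}" "z \<in> E `` {x}" "c' x y = c' x z"
      have special: "c' x b \<noteq> k" if "(x, b) \<in> E'" "x = u \<or> x = v" for b
        using that k by (auto simp: c'_def U_def E'_def)
      consider "(x, y) \<in> E'" "(x, z) \<in> E'" | "(x, y) \<notin> E'" | "(x, z) \<notin> E'" by blast
      then show "y = z"
      proof cases
        case 1
        then have "c x y = c x z" using yz(3) by (auto simp: c'_def E'_def)
        then show ?thesis using inj[of x] 1 by (auto dest: inj_onD)
      next
        case 2
        then have x: "x = u \<or> x = v" "c' x y = k" using yz by (auto simp: E'_def c'_def)
        then have "(x, z) \<notin> E'" using special yz(3) by auto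
        then show ?thesis using 2 yz ne by (auto simp: E'_def)
      next
        case 3
        then have x: "x = u \<or> x = v" "c' x z = k" using yz by (auto simp: E'_def c'_def)
        then have "(x, y) \<notin> E'" using special yz(3) by auto
        then show ?thesis using 3 yz ne by (auto simp: E'_def)
      qed
    qed
    ultimately show ?thesis by blast
  qed
qed

text \<open>
  Each colour class is a matching, so a uniformly random colour separates a given pair \<open>(w, u)\<close> with
  probability at least 1/4. Choosing colours greedily, logarithmically many of them separate all pairs.
\<close>

definition unseparated :: "'a rel \<Rightarrow> ('a \<Rightarrow> 'a \<Rightarrow> nat) \<Rightarrow> 'a set \<Rightarrow> nat set \<Rightarrow> ('a \<times> 'a) set" where
  "unseparated E c V C =
     {(w, u). w \<in> V \<and> u \<in> V \<and> w \<noteq> u \<and> (\<forall>s. (w, s) \<in> E \<longrightarrow> c w s \<in> C \<longrightarrow> (u, s) \<in> E)}"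

text \<open>At least d / 2 neighbours of w are not neighbours of u, and their edges to w have
  distinct colours. So at least a quarter of the 2 * d colours separate any given pair, and by
  averaging some colour separates a quarter of the pairs in
  \<open>unseparated E c V C\<close>.\<close>

lemma separating_colours_step:
  fixes E :: "'a rel"
  assumes finV: "finite V"
    and c: "\<And>u v. (u, v) \<in> E \<Longrightarrow> c u v < 2 * d" and inj: "\<And>u. inj_on (c u) (E `` {u})"
    and codeg: "\<And>w u. w \<in> V \<Longrightarrow> u \<in> V \<Longrightarrow> w \<noteq> u \<Longrightarrow>
      d \<le> 2 * card (E `` {w} - E `` {u})"
    and d: "0 < d"
  shows "\<exists>k. 4 * card (unseparated E c V (insert k C)) \<le> 3 * card (unseparated E c V C)"
proof (rule ccontr)
  define P where "P = unseparated E c V C"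
  \<comment> \<open>The pairs that become separated when colour k is added.\<close>
  define S where "S = (\<lambda>k. {(w, u) \<in> P. \<exists>s. (w, s) \<in> E \<and> c w s = k \<and> (u, s) \<notin> E})"
  have finP: "finite P"
    by (rule finite_subset[of _ "V \<times> V"]) (use finV in \<open>auto simp: P_def unseparated_def\<close>)
  assume "\<not> ?thesis"
  then have less: "3 * card P < 4 * card (unseparated E c V (insert k C))" for k
    by (auto simp: P_def not_le)
  have "unseparated E c V (insert k C) = P - S k" for k
    by (auto simp: P_def S_def unseparated_def)
  then have "card (unseparated E c V (insert k C)) = card P - card (S k)" for k
    using finP by (auto simp: S_def intro!: card_Diff_subset finite_subset[of _ P])
  then have lt: "4 * card (S k) < card P" for k using less[of k] by auto
  have "card P * d = (\<Sum>p\<in>P. d)" by simp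
  also have "\<dots> \<le> (\<Sum>p\<in>P. 2 * card {k \<in> {..<2 * d}. p \<in> S k})"
  proof (rule sum_mono, clarify)
    fix w u assume p: "(w, u) \<in> P"
    then have "d \<le> 2 * card (E `` {w} - E `` {u})"
      using codeg by (auto simp: P_def unseparated_def)
    also have "card (E `` {w} - E `` {u}) \<le> card {k \<in> {..<2 * d}. (w, u) \<in> S k}"
    proof (rule card_inj_on_le)
      show "inj_on (c w) (E `` {w} - E `` {u})" using inj by (rule inj_on_subset) auto
      show "c w ` (E `` {w} - E `` {u}) \<subseteq> {k \<in> {..<2 * d}. (w, u) \<in> S k}"
        using p c by (auto simp: S_def)
    qed simp
    finally show "d \<le> 2 * card {k \<in> {..<2 * d}. (w, u) \<in> S k}" by simp
  qed
  also have "\<dots> = 2 * (\<Sum>p\<in>P. card {k \<in> {..<2 * d}. p \<in> S k})"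
    by (simp add: sum_distrib_left)
  also have "(\<Sum>p\<in>P. card {k \<in> {..<2 * d}. p \<in> S k}) = (\<Sum>k<2 * d. card {p \<in> P. p \<in> S k})"
    by (rule sum_multicount_gen) (use finP in auto)
  also have "\<dots> = (\<Sum>k<2 * d. card (S k))"
    by (intro sum.cong arg_cong[of _ _ card]) (auto simp: S_def)
  finally have le: "card P * d \<le> 2 * (\<Sum>k<2 * d. card (S k))" .
  have "4 * (\<Sum>k<2 * d. card (S k)) < (\<Sum>k<2 * d. card P)"
    unfolding sum_distrib_left using lt d
    by (intro sum_strict_mono) (auto simp: lessThan_empty_iff)
  then show False using le by (simp add: mult.commute)
qed

text \<open>After j steps at most (3/4)^j * (card V)^2 pairs are left. The condition on
  \<open>K\<close> makes this less than 1 for j = K.\<close>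

lemma separating_colours_exist:
  fixes E :: "'a rel"
  assumes finV: "finite V"
    and c: "\<And>u v. (u, v) \<in> E \<Longrightarrow> c u v < 2 * d" and inj: "\<And>u. inj_on (c u) (E `` {u})"
    and codeg: "\<And>w u. w \<in> V \<Longrightarrow> u \<in> V \<Longrightarrow> w \<noteq> u \<Longrightarrow>
      d \<le> 2 * card (E `` {w} - E `` {u})"
    and d: "0 < d" and K: "(card V)\<^sup>2 * 3 ^ K < (4::nat) ^ K"
  shows "\<exists>C. finite C \<and> card C \<le> K \<and> unseparated E c V C = {}"
proof -
  have "\<exists>C. finite C \<and> card C \<le> j \<and> 4 ^ j * card (unseparated E c V C) \<le> 3 ^ j * (card V)\<^sup>2" for j
  proof (induction j)
    case 0
    have "card (unseparated E c V {}) \<le> card (V \<times> V)"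
      using finV by (intro card_mono) (auto simp: unseparated_def)
    then show ?case
      using finV by (intro exI[of _ "{}"]) (simp add: card_cartesian_product power2_eq_square)
  next
    case (Suc j)
    then obtain C where C: "finite C" "card C \<le> j"
      "4 ^ j * card (unseparated E c V C) \<le> 3 ^ j * (card V)\<^sup>2" by blast
    obtain k where k: "4 * card (unseparated E c V (insert k C)) \<le> 3 * card (unseparated E c V C)"
      using separating_colours_step[OF finV c inj codeg d] by blast
    have "4 ^ Suc j * card (unseparated E c V (insert k C))
        = 4 ^ j * (4 * card (unseparated E c V (insert k C)))" by simp
    also have "\<dots> \<le> 4 ^ j * (3 * card (unseparated E c V C))"
      using k by (intro mult_left_mono) auto
    also have "\<dots> = 3 * (4 ^ j * card (unseparated E c V C))" by simp
    also have "\<dots> \<le> 3 * (3 ^ j * (card V)\<^sup>2)"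
      using C by (intro mult_left_mono) auto
    finally have "4 ^ Suc j * card (unseparated E c V (insert k C)) \<le> 3 ^ Suc j * (card V)\<^sup>2"
      by simp
    moreover have "card (insert k C) \<le> Suc j" using C card_insert_le_m1[of "Suc j" C k] by simp
    ultimately show ?case using C(1) by blast
  qed
  from this[of K] obtain C where C: "finite C" "card C \<le> K"
    "4 ^ K * card (unseparated E c V C) \<le> 3 ^ K * (card V)\<^sup>2" by blast
  have "4 ^ K * card (unseparated E c V C) < 4 ^ K * 1"
    using C(3) K by (simp only: mult.commute[of "3 ^ K"] mult_1_right)
  then have "card (unseparated E c V C) = 0" by (simp only: mult_less_cancel1 less_one)
  moreover have "finite (unseparated E c V C)"
    by (rule finite_subset[of _ "V \<times> V"]) (use finV in \<open>auto simp: unseparated_def\<close>)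
  ultimately show ?thesis using C by auto
qed

section \<open>Frozen homomorphisms\<close>

text \<open>Moving one vertex at a time from \<phi>, no vertex of \<open>C\<close> can be the first
  to change: its neighbours in \<open>C\<close> still have their values under \<phi>, and these
  leave it no other value.\<close>

lemma frozen_imp_not_path_connected:
  assumes \<phi>: "\<phi> \<in> graph_homs H G" and \<psi>: "\<psi> \<in> graph_homs H G"
    and C: "C \<subseteq> pverts H" and irr: "\<And>x. (x, x) \<notin> parcs H"
    and frozen: "\<And>x y. x \<in> C \<Longrightarrow> y \<in> pverts G \<Longrightarrow>
      (\<And>z. z \<in> C \<Longrightarrow> (x, z) \<in> parcs H \<Longrightarrow> (y, \<phi> z) \<in> parcs G) \<Longrightarrow> y = \<phi> x"
    and differ: "x0 \<in> C" "\<psi> x0 \<noteq> \<phi> x0"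
  shows "\<not> path_connected_graph (Hom_graph H G)"
proof
  assume "path_connected_graph (Hom_graph H G)"
  then have "(\<phi>, \<psi>) \<in> rtrancl_on (pverts (Hom_graph H G)) (parcs (Hom_graph H G))"
    using \<phi> \<psi> by (auto simp: path_connected_graph_def Hom_graph_def reachable_def)
  then have "\<forall>x\<in>C. \<psi> x = \<phi> x"
  proof (induction rule: rtrancl_on_induct)
    case base
    then show ?case by simp
  next
    case (step \<rho> \<sigma>)
    then have hom: "\<rho> \<in> graph_homs H G" "\<sigma> \<in> graph_homs H G"
      and ex: "\<exists>!v. v \<in> pverts H \<and> \<rho> v \<noteq> \<sigma> v" by (auto simp: Hom_graph_def)
    then obtain v where v: "v \<in> pverts H" "\<rho> v \<noteq> \<sigma> v"
      "\<And>z. z \<in> pverts H \<Longrightarrow> \<rho> z \<noteq> \<sigma> z \<Longrightarrow> z = v" by blast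
    have "v \<notin> C"
    proof
      assume vC: "v \<in> C"
      have "\<sigma> v = \<phi> v"
      proof (rule frozen[OF vC])
        show "\<sigma> v \<in> pverts G" using hom(2) v(1) by (auto simp: graph_homs_def)
        fix z assume z: "z \<in> C" "(v, z) \<in> parcs H"
        \<comment> \<open>Only v moves in this step, and v is not adjacent to itself, so z keeps its
          value.\<close>
        then have "z \<noteq> v" using irr by auto
        then have "\<rho> z = \<sigma> z" using z(1) C v(3)[of z] by blast
        then have "\<sigma> z = \<phi> z" using z(1) step.IH by metis
        moreover have "(\<sigma> v, \<sigma> z) \<in> parcs G" using hom(2) z by (auto simp: graph_homs_def)
        ultimately show "(\<sigma> v, \<phi> z) \<in> parcs G" by simp
      qed
      then show False using v(2) step.IH vC by simp
    qed
    then show ?case using step.IH v(3) C by (metis subsetD)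
  qed
  then show False using differ by auto
qed

text \<open>
  The graph \<open>H\<close> is the bipartite double cover of the graph formed by the separating colour classes,
  together with a disjoint star which brings the maximum degree up to \<open>D - 2\<close>. The vertex \<open>2 * w + b\<close>
  with \<open>b < 2\<close> is the copy of \<open>w\<close> on side \<open>b\<close>. The covering projection is frozen on the double cover,
  which can also be folded onto a single edge of \<open>G\<close>.
\<close>

lemma not_mobile_if_small_codegree:
  assumes E: "E \<in> regular_rels n d" and d: "0 < d"
    and codeg: "\<And>w u. w < n \<Longrightarrow> u < n \<Longrightarrow> w \<noteq> u \<Longrightarrow> 2 * card (E `` {w} \<inter> E `` {u}) \<le> d"
    and K: "n\<^sup>2 * 3 ^ K < (4::nat) ^ K" and D: "K + 2 \<le> D" "3 \<le> D"
    and n: "0 < n"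
  shows "\<not> mobile D \<lparr> pverts = {..<n}, parcs = E \<rparr>"
proof -
  let ?G = "\<lparr> pverts = {..<n}, parcs = E \<rparr>"
  have sym: "sym E" and irr: "irrefl E" and sub: "E \<subseteq> {..<n} \<times> {..<n}"
    using E by (auto simp: regular_rels_def)
  obtain c :: "nat \<Rightarrow> nat \<Rightarrow> nat"
    where c: "\<And>u v. (u, v) \<in> E \<Longrightarrow> c u v < 2 * d \<and> c u v = c v u"
      and inj: "\<And>u. inj_on (c u) (E `` {u})"
    using proper_edge_colouring_exists[OF finite_regular_rel[OF E] sym irr
        card_regular_rel_Image_le[OF E] d] by blast
  have "d \<le> 2 * card (E `` {w} - E `` {u})" if "w < n" "u < n" "w \<noteq> u" for w u
  proof -
    have "card (E `` {w} - E `` {u}) = card (E `` {w}) - card (E `` {w} \<inter> E `` {u})"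
      using finite_regular_rel_Image[OF E] by (intro card_Diff_subset_Int) auto
    then show ?thesis using codeg[OF that] E that(1) by (auto simp: regular_rels_def)
  qed
  then obtain C where C: "finite C" "card C \<le> K" "unseparated E c {..<n} C = {}"
    using separating_colours_exist[of "{..<n}" E c d K] c inj d K by auto
  obtain a b where ab: "(a, b) \<in> E"
  proof -
    have "card (E `` {0}) > 0" using E n d by (auto simp: regular_rels_def)
    then show ?thesis using that by (auto simp: card_gt_0_iff)
  qed
  then have ba: "(b, a) \<in> E" and ne: "a \<noteq> b" and lt: "a < n" "b < n"
    using sym irr sub by (auto dest: symD simp: irrefl_def)
  define L where "L = D - 2"
  have L: "K \<le> L" "1 \<le> L" "L + 2 = D" using D by (auto simp: L_def)
  define cover where "cover = {(x, y). x < 2 * n \<and> y < 2 * n \<and> even x \<noteq> even y \<and>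
    (x div 2, y div 2) \<in> E \<and> c (x div 2) (y div 2) \<in> C}"
  define star where "star = {2 * n} \<times> {2 * n<..2 * n + L} \<union> {2 * n<..2 * n + L} \<times> {2 * n}"
  define H where "H = \<lparr> pverts = {..2 * n + L}, parcs = cover \<union> star \<rparr>"
  have symH: "sym (parcs H)"
    using c sym by (auto simp: H_def cover_def star_def sym_def)
  have subH: "parcs H \<subseteq> {..2 * n + L} \<times> {..2 * n + L}"
    by (auto simp: H_def cover_def star_def)
  have irrH: "(x, x) \<notin> parcs H" for x by (auto simp: H_def cover_def star_def)
  have "pair_graph H"
  proof unfold_locales
    show "finite (parcs H)" using subH by (rule finite_subset) auto
    show "fst e \<in> pverts H" "snd e \<in> pverts H" if "e \<in> parcs H" for e
      using subH that by (auto simp: H_def)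
    show "fst e \<noteq> snd e" if "e \<in> parcs H" for e
      using irrH that by (cases e) auto
    show "symmetric (with_proj H)" using symH by (simp add: symmetric_def)
  qed (simp add: H_def)
  have deg: "out_degree (with_proj H) x \<le> L" for x
  proof -
    consider "x < 2 * n" | "x = 2 * n" | "x > 2 * n" by linarith
    then have "card (parcs H `` {x}) \<le> L"
    proof cases
      case 1
      \<comment> \<open>A neighbour of x is determined by its parity, which is opposite to that of
        x, and by its projection, which the edge colour determines. Hence there are at most
        \<open>card C\<close> neighbours.\<close>
      have "card (parcs H `` {x}) \<le> card C"
      proof (rule card_inj_on_le)
        let ?f = "\<lambda>y. c (x div 2) (y div 2)"
        show "?f ` (parcs H `` {x}) \<subseteq> C"
          using 1 by (auto simp: H_def cover_def star_def)
        show "inj_on ?f (parcs H `` {x})"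
        proof (rule inj_onI)
          fix y z assume yz: "y \<in> parcs H `` {x}" "z \<in> parcs H `` {x}" "?f y = ?f z"
          then have "(x div 2, y div 2) \<in> E" "(x div 2, z div 2) \<in> E" "even y = even z"
            using 1 by (auto simp: H_def cover_def star_def)
          then have "y div 2 = z div 2" using inj yz(3) by (auto dest: inj_onD)
          with \<open>even y = even z\<close> show "y = z" by presburger
        qed
      qed (fact C)
      then show ?thesis using C L by simp
    next
      case 2
      then have "parcs H `` {x} = {2 * n<..2 * n + L}" by (auto simp: H_def cover_def star_def)
      then show ?thesis by simp
    next
      case 3
      then have "parcs H `` {x} \<subseteq> {2 * n}" by (auto simp: H_def cover_def star_def)
      then have "card (parcs H `` {x}) \<le> card {2 * n}" by (rule card_mono[rotated]) simp
      then show ?thesis using L by simp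
    qed
    then show ?thesis by (simp add: out_degree_eq_card_Image)
  qed
  have "parcs H `` {2 * n} = {2 * n<..2 * n + L}" by (auto simp: H_def cover_def star_def)
  then have "out_degree (with_proj H) (2 * n) = L" by (simp add: out_degree_eq_card_Image)
  then have "L \<in> out_degree (with_proj H) ` pverts H"
    by (auto simp: H_def image_iff intro!: bexI[of _ "2 * n"])
  then have "max_degree H = L"
    unfolding max_degree_def using deg by (intro Max_eqI) (auto simp: H_def)
  define \<phi> where "\<phi> = restrict (\<lambda>x. if x < 2 * n then x div 2 else if x = 2 * n then a else b)
    {..2 * n + L}"
  define \<psi> where "\<psi> = restrict (\<lambda>x. if x < 2 * n then if even x then a else b
    else if x = 2 * n then a else b) {..2 * n + L}"
  have \<phi>: "\<phi> \<in> graph_homs H ?G"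
    using ab ba lt by (auto simp: graph_homs_def H_def \<phi>_def cover_def star_def)
  have \<psi>: "\<psi> \<in> graph_homs H ?G"
    using ab ba lt by (auto simp: graph_homs_def H_def \<psi>_def cover_def star_def)
  have "\<not> path_connected_graph (Hom_graph H ?G)"
  \<comment> \<open>The copy of b on the even side is projected to b but folded to a.\<close>
  proof (rule frozen_imp_not_path_connected[OF \<phi> \<psi>, of "{..<2 * n}" "2 * b"])
    show "{..<2 * n} \<subseteq> pverts H" by (auto simp: H_def)
    show "2 * b \<in> {..<2 * n}" "\<psi> (2 * b) \<noteq> \<phi> (2 * b)"
      using lt ne by (auto simp: \<phi>_def \<psi>_def)
  next
    fix x y
    assume x: "x \<in> {..<2 * n}" and y: "y \<in> pverts ?G"
      and adj: "\<And>z. z \<in> {..<2 * n} \<Longrightarrow> (x, z) \<in> parcs H \<Longrightarrow> (y, \<phi> z) \<in> parcs ?G"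
    show "y = \<phi> x"
    proof (rule ccontr)
      assume "y \<noteq> \<phi> x"
      then have "x div 2 \<noteq> y" "x div 2 < n" "y < n" using x y by (auto simp: \<phi>_def)
      then obtain s where s: "(x div 2, s) \<in> E" "c (x div 2) s \<in> C" "(y, s) \<notin> E"
        using C(3) by (auto simp: unseparated_def)
      \<comment> \<open>The copy of s on the side opposite to x. It is adjacent to x in the cover,
        while s is not a neighbour of y.\<close>
      define z where "z = 2 * s + (1 - x mod 2)"
      have "s < n" using s sub by auto
      then have z: "z < 2 * n" "z div 2 = s" "even z \<noteq> even x"
        by (auto simp: z_def parity_cases)
      then have "(x, z) \<in> parcs H" using s x by (auto simp: H_def cover_def)
      from adj[OF _ this] show False using z s by (simp add: \<phi>_def)
    qed
  qed (fact irrH)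
  then show ?thesis
    using \<open>pair_graph H\<close> \<open>max_degree H = L\<close> L(3) by (auto simp: mobile_def H_def)
qed

section \<open>The chromatic number\<close>

text \<open>Let f v count the neighbours of v in \<open>I\<close>. Its sum counts the edges leaving
  \<open>I\<close>, and the sum of its squares counts the common neighbours of ordered pairs from
  \<open>I\<close>. Since f vanishes on the independent set, Cauchy-Schwarz is applied to the n -
  card I other vertices only.\<close>

lemma independent_set_bound:
  assumes E: "E \<in> regular_rels n d" and I: "I \<subseteq> {..<n}"
    and indep: "\<And>u v. u \<in> I \<Longrightarrow> v \<in> I \<Longrightarrow> (u, v) \<notin> E"
    and codeg: "\<And>w u. w < n \<Longrightarrow> u < n \<Longrightarrow> w \<noteq> u \<Longrightarrow> card (E `` {w} \<inter> E `` {u}) \<le> t"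
  shows "(real (card I) * d)\<^sup>2 \<le> (real n - card I) * (real (card I) * d + (real (card I))\<^sup>2 * t)"
proof -
  have finI: "finite I" using I finite_subset by blast
  have sym: "(x, y) \<in> E \<longleftrightarrow> (y, x) \<in> E" for x y
    using E by (auto simp: regular_rels_def dest: symD)
  have sub: "x < n \<and> y < n" if "(x, y) \<in> E" for x y
    using E that by (auto simp: regular_rels_def)
  define f where "f v = card {u \<in> I. (v, u) \<in> E}" for v
  have f0: "f v = 0" if "v \<in> I" for v
  proof -
    have "{u \<in> I. (v, u) \<in> E} = {}" using indep that by auto
    then show ?thesis unfolding f_def by (simp only: card.empty)
  qed
  have "(\<Sum>v<n. f v) = (\<Sum>u\<in>I. card {v \<in> {..<n}. (v, u) \<in> E})"
    unfolding f_def by (rule sum_multicount_gen) (use finI in auto)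
  also have "\<dots> = (\<Sum>u\<in>I. d)"
  proof (rule sum.cong)
    fix u assume "u \<in> I"
    moreover have "{v \<in> {..<n}. (v, u) \<in> E} = E `` {u}" using sym by (auto dest: sub)
    ultimately show "card {v \<in> {..<n}. (v, u) \<in> E} = d"
      using E I by (auto simp: regular_rels_def)
  qed simp
  also have "\<dots> = card I * d" by simp
  also have "(\<Sum>v<n. f v) = (\<Sum>v\<in>{..<n} - I. f v)"
    using f0 by (intro sum.mono_neutral_right) auto
  finally have sum1: "(\<Sum>v\<in>{..<n} - I. f v) = card I * d" .
  have "(\<Sum>v\<in>{..<n} - I. (f v)\<^sup>2) \<le> (\<Sum>v<n. (f v)\<^sup>2)"
    by (intro sum_mono2) auto
  also have "\<dots> = (\<Sum>v<n. card {p \<in> I \<times> I. (v, fst p) \<in> E \<and> (v, snd p) \<in> E})"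
  proof (rule sum.cong)
    fix v
    have "{p \<in> I \<times> I. (v, fst p) \<in> E \<and> (v, snd p) \<in> E} = {u \<in> I. (v, u) \<in> E} \<times> {u \<in> I. (v, u) \<in> E}"
      by auto
    then show "(f v)\<^sup>2 = card {p \<in> I \<times> I. (v, fst p) \<in> E \<and> (v, snd p) \<in> E}"
      by (simp add: f_def card_cartesian_product power2_eq_square)
  qed simp
  also have "\<dots> = (\<Sum>p\<in>I \<times> I. card {v \<in> {..<n}. (v, fst p) \<in> E \<and> (v, snd p) \<in> E})"
    by (rule sum_multicount_gen) (use finI in auto)
  also have "\<dots> = (\<Sum>u\<in>I. \<Sum>w\<in>I. card (E `` {u} \<inter> E `` {w}))"
    unfolding sum.cartesian_product
  proof (intro sum.cong refl, clarify)
    fix u w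
    have "{v \<in> {..<n}. (v, fst (u, w)) \<in> E \<and> (v, snd (u, w)) \<in> E} = E `` {u} \<inter> E `` {w}"
      using sym by (auto dest: sub)
    then show "card {v \<in> {..<n}. (v, fst (u, w)) \<in> E \<and> (v, snd (u, w)) \<in> E}
      = card (E `` {u} \<inter> E `` {w})" by simp
  qed
  \<comment> \<open>The diagonal pair contributes the degree d, every other pair at most t.\<close>
  also have "\<dots> \<le> (\<Sum>u\<in>I. d + card I * t)"
  proof (rule sum_mono)
    fix u assume u: "u \<in> I"
    have "(\<Sum>w\<in>I. card (E `` {u} \<inter> E `` {w}))
        = card (E `` {u} \<inter> E `` {u}) + (\<Sum>w\<in>I - {u}. card (E `` {u} \<inter> E `` {w}))"
      using finI u by (rule sum.remove)
    also have "\<dots> \<le> d + (\<Sum>w\<in>I - {u}. t)"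
      using u I E codeg by (intro add_mono sum_mono) (auto simp: card_regular_rel_Image_le)
    also have "(\<Sum>w\<in>I - {u}. t) \<le> card I * t"
      using finI by (simp add: card_Diff_subset_Int)
    finally show "(\<Sum>w\<in>I. card (E `` {u} \<inter> E `` {w})) \<le> d + card I * t" by simp
  qed
  also have "\<dots> = card I * d + (card I)\<^sup>2 * t" by (simp add: algebra_simps power2_eq_square)
  finally have "(\<Sum>v\<in>{..<n} - I. (f v)\<^sup>2) \<le> card I * d + (card I)\<^sup>2 * t" .
  from of_nat_mono[OF this]
  have sum2: "(\<Sum>v\<in>{..<n} - I. (real (f v))\<^sup>2) \<le> real (card I) * d + (real (card I))\<^sup>2 * t"
    by simp
  have card: "real (card ({..<n} - I)) = real n - card I"
    using I finI card_mono[OF _ I] by (simp add: card_Diff_subset)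
  have "(real (card I) * d)\<^sup>2 = (\<Sum>v\<in>{..<n} - I. real (f v))\<^sup>2"
    by (simp flip: sum1 of_nat_mult of_nat_sum)
  also have "\<dots> \<le> real (card ({..<n} - I)) * (\<Sum>v\<in>{..<n} - I. (real (f v))\<^sup>2)"
    using sum_squared_le_sum_of_squares[of "\<lambda>v. real (f v)" "{..<n} - I"]
    by (simp add: mult.commute)
  also have "\<dots> \<le> real (card ({..<n} - I)) * (real (card I) * d + (real (card I))\<^sup>2 * t)"
    using sum2 by (intro mult_left_mono) auto
  finally show ?thesis by (simp add: card)
qed

text \<open>Some colour class has a >= n / k vertices and is independent, so
  \<open>independent_set_bound\<close> applies to it. The two alternatives reflect whether the error
  term with \<epsilon> can be absorbed.\<close>

lemma chromatic_number_lower_bound: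
  assumes E: "E \<in> regular_rels n d" and d: "0 < d" and n: "0 < n"
    and codeg: "\<And>w u. w < n \<Longrightarrow> u < n \<Longrightarrow> w \<noteq> u \<Longrightarrow> card (E `` {w} \<inter> E `` {u}) \<le> t"
    and t: "real t \<le> (1 + \<epsilon>) * (real d)\<^sup>2 / n" and \<epsilon>: "0 < \<epsilon>"
    and k: "k = chromatic_number \<lparr> pverts = {..<n}, parcs = E \<rparr>"
  shows "1 \<le> 2 * \<epsilon> * k \<or> real d \<le> 2 * (real k)\<^sup>2"
proof -
  define col where "col k c \<longleftrightarrow> c \<in> {..<n} \<rightarrow> {..<k} \<and> (\<forall>(u, v) \<in> E. c u \<noteq> c v)"
    for k and c :: "nat \<Rightarrow> nat"
  have keq: "k = (LEAST k. \<exists>c. col k c)"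
    unfolding k chromatic_number_def col_def by (simp add: Bex_def)
  have "col n id" using E by (auto simp: col_def regular_rels_def irrefl_def)
  then have "\<exists>k c. col k c" by blast
  from LeastI_ex[OF this] have "\<exists>c. col k c" unfolding keq .
  then obtain c where c: "c \<in> {..<n} \<rightarrow> {..<k}" "\<And>u v. (u, v) \<in> E \<Longrightarrow> c u \<noteq> c v"
    unfolding col_def by blast
  define I where "I i = {v \<in> {..<n}. c v = i}" for i
  have "k > 0" using c(1) n by (cases "k = 0") auto
  have "(\<Union>i<k. I i) = {..<n}" using c(1) by (auto simp: I_def)
  then have "n \<le> (\<Sum>i<k. card (I i))" using card_UN_le[of "{..<k}" I] by simp
  have "\<exists>i<k. n \<le> k * card (I i)"
  proof (rule ccontr)
    assume "\<not> ?thesis"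
    then have "(\<Sum>i<k. k * card (I i)) < (\<Sum>i<k. n)"
      using \<open>k > 0\<close> by (intro sum_strict_mono) (auto simp: not_le lessThan_empty_iff)
    then show False using \<open>n \<le> _\<close> by (simp flip: sum_distrib_left)
  qed
  then obtain i where i: "n \<le> k * card (I i)" by blast
  define a where "a = real (card (I i))"
  have "a > 0" using i n by (auto simp: a_def intro: Nat.gr0I)
  have "card (I i) \<le> card {..<n}" by (intro card_mono) (auto simp: I_def)
  then have "a \<le> n" by (simp add: a_def)
  have ka: "real n \<le> k * a" using i by (simp add: a_def flip: of_nat_mult)
  have "(a * d)\<^sup>2 \<le> (real n - a) * (a * d + a\<^sup>2 * t)"
    unfolding a_def by (rule independent_set_bound[OF E _ _ codeg]) (auto simp: I_def dest: c(2))
  also have "\<dots> \<le> (real n - a) * (a * d + a\<^sup>2 * ((1 + \<epsilon>) * (real d)\<^sup>2 / n))"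
    using t \<open>a \<le> n\<close> by (intro mult_left_mono add_left_mono) auto
  also have "\<dots> = a * d * ((real n - a) * (n + a * (1 + \<epsilon>) * d) / n)"
    using n by (simp add: field_simps power2_eq_square)
  finally have "a * d * (a * d) \<le> a * d * ((real n - a) * (n + a * (1 + \<epsilon>) * d) / n)"
    by (simp add: power2_eq_square)
  then have "a * d \<le> (real n - a) * (n + a * (1 + \<epsilon>) * d) / n"
    using \<open>a > 0\<close> d by (subst (asm) mult_le_cancel_left_pos) auto
  then have "a * d * n \<le> (real n - a) * (n + a * (1 + \<epsilon>) * d)"
    using n by (simp add: pos_le_divide_eq)
  \<comment> \<open>The leading terms a * d * n on both sides cancel because the codegrees are
    bounded by nearly d^2 / n. What remains is a^2 * d against n^2 and the \<epsilon>-error.\<close>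
  also have "\<dots> = (real n)\<^sup>2 - a * n + a * d * n + \<epsilon> * n * (a * d) - a\<^sup>2 * d - \<epsilon> * (a\<^sup>2 * d)"
    by (simp add: algebra_simps power2_eq_square)
  also have "\<dots> \<le> (real n)\<^sup>2 + a * d * n + \<epsilon> * n * (a * d) - a\<^sup>2 * d"
  proof -
    have "0 \<le> a * n" "0 \<le> \<epsilon> * (a\<^sup>2 * d)" using \<open>a > 0\<close> \<epsilon> by simp_all
    then show ?thesis by linarith
  qed
  finally have 1: "a\<^sup>2 * d \<le> (real n)\<^sup>2 + \<epsilon> * n * (a * d)" by simp
  show ?thesis
  proof (cases "1 \<le> 2 * \<epsilon> * k")
    case False
    \<comment> \<open>Here 2 * \<epsilon> * k < 1, so the \<epsilon>-error is at most half of a^2 *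
      d.\<close>
    have "2 * \<epsilon> * n \<le> 2 * \<epsilon> * (k * a)" using ka \<epsilon> by (intro mult_left_mono) auto
    also have "\<dots> = 2 * \<epsilon> * k * a" by simp
    also have "\<dots> \<le> 1 * a" using False \<open>a > 0\<close> by (intro mult_right_mono) auto
    finally have "2 * \<epsilon> * n * (a * d) \<le> a * (a * d)"
      using \<open>a > 0\<close> by (intro mult_right_mono) auto
    then have "a\<^sup>2 * d \<le> 2 * (real n)\<^sup>2" using 1 by (simp add: power2_eq_square)
    also have "\<dots> \<le> 2 * (k * a)\<^sup>2" using ka by simp
    also have "\<dots> = a\<^sup>2 * (2 * (real k)\<^sup>2)" by (simp add: power_mult_distrib)
    finally show ?thesis using \<open>a > 0\<close> by simp
  qed simp
qed

section \<open>Random regular graphs\<close>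

definition large_codegree :: "nat \<Rightarrow> nat \<Rightarrow> nat rel \<Rightarrow> bool" where
  "large_codegree n t E \<longleftrightarrow> (\<exists>w<n. \<exists>u<n. w \<noteq> u \<and> t \<le> card (E `` {w} \<inter> E `` {u}))"

text \<open>Union bound over at most n^2 pairs. The number q bounds the quotient whose r-th power
  \<open>card_large_codegree_le\<close> provides.\<close>

lemma card_large_codegree_le_power:
  assumes "r \<le> t" "0 < n" "0 < d"
    and q: "real n * real d ^ 4
      \<le> q * (real (t - r) * (real (n * d - 2 * d * (d + 1) - 4 * r))\<^sup>2)"
  shows "real (card {E \<in> regular_rels n d. large_codegree n t E})
    \<le> (real n)\<^sup>2 * q ^ r * card (regular_rels n d)"
proof -
  let ?Q = "regular_rels n d"
  define X where "X = (t - r) * (n * d - 2 * d * (d + 1) - 4 * r)\<^sup>2"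
  define B where "B = (\<lambda>(w, u). {E \<in> ?Q. t \<le> card (E `` {w} \<inter> E `` {u})})"
  define P where "P = {(w, u). w < n \<and> u < n \<and> w \<noteq> u}"
  have P: "P \<subseteq> {..<n} \<times> {..<n}" by (auto simp: P_def)
  then have finP: "finite P" by (rule finite_subset) auto
  have "card P \<le> card ({..<n} \<times> {..<n})" using P by (intro card_mono) auto
  then have cardP: "card P \<le> n\<^sup>2" by (simp add: card_cartesian_product power2_eq_square)
  have qX: "real n * real d ^ 4 \<le> q * real X" using q by (simp add: X_def)
  moreover have "0 < real n * real d ^ 4" using assms by simp
  ultimately have "0 < q * real X" by linarith
  then have "0 < X" "0 < q" by (auto simp: zero_less_mult_iff)
  have B: "real (card (B p)) \<le> card ?Q * q ^ r" if "p \<in> P" for p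
  proof -
    obtain w u where p: "p = (w, u)" "w \<noteq> u" using \<open>p \<in> P\<close> by (auto simp: P_def)
    have "card (B p) * X ^ r \<le> card ?Q * (n * d ^ 4) ^ r"
      using card_large_codegree_le[OF p(2) assms(1), of n d] by (simp add: p B_def X_def)
    then have "real (card (B p) * X ^ r) \<le> real (card ?Q * (n * d ^ 4) ^ r)"
      by (rule of_nat_mono)
    then have "real (card (B p)) * real X ^ r \<le> card ?Q * (real n * real d ^ 4) ^ r" by simp
    also have "\<dots> \<le> card ?Q * (q * real X) ^ r"
      using qX by (intro mult_left_mono power_mono) auto
    also have "\<dots> = card ?Q * q ^ r * real X ^ r" by (simp add: power_mult_distrib)
    finally show ?thesis using \<open>0 < X\<close> by simp
  qed
  have "{E \<in> ?Q. large_codegree n t E} = (\<Union>p\<in>P. B p)"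
    by (auto simp: large_codegree_def B_def P_def)
  then have "real (card {E \<in> ?Q. large_codegree n t E}) \<le> real (\<Sum>p\<in>P. card (B p))"
    using card_UN_le[OF finP, of B] by (simp only: of_nat_le_iff)
  also have "\<dots> \<le> (\<Sum>p\<in>P. card ?Q * q ^ r)"
    unfolding of_nat_sum using B by (intro sum_mono) auto
  also have "\<dots> = card P * (card ?Q * q ^ r)" by simp
  also have "\<dots> \<le> real (n\<^sup>2) * (card ?Q * q ^ r)"
    using cardP \<open>0 < q\<close> by (intro mult_right_mono of_nat_mono) auto
  finally show ?thesis by (simp add: mult_ac)
qed

text \<open>With c = d^2 / n, the threshold t exceeds c by the relative amount 1 / y, whereas the
  losses from r and from the switchings are of relative order 1 / y^2. Half of the gain survives,
  which is what \<open>est\<close> expresses.\<close>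

lemma switching_ratio_bound:
  fixes n d :: nat and y :: real
  defines "r \<equiv> nat \<lceil>y\<^sup>2\<rceil>"
    and "t \<equiv> nat \<lfloor>(1 + 1 / y) * (real d)\<^sup>2 / n\<rfloor> + 1"
  assumes y: "4 \<le> y" and yn: "y\<^sup>2 \<le> n" and yd: "y\<^sup>2 * d \<le> n" and dn: "n * y ^ 4 \<le> (real d)\<^sup>2"
    and est: "1 + 1 / (2 * y) \<le> (1 - 12 / y\<^sup>2)\<^sup>2 * (1 + 1 / y - 2 / y\<^sup>2)"
  shows "r \<le> t"
    and "real n * real d ^ 4 \<le> 1 / (1 + 1 / (2 * y)) *
      (real (t - r) * (real (n * d - 2 * d * (d + 1) - 4 * r))\<^sup>2)"
proof -
  have y2: "16 \<le> y\<^sup>2" using power_mono[OF y, of 2] by simp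
  have n: "0 < real n" using y2 yn by linarith
  have "1 * y ^ 4 \<le> n * y ^ 4" using y2 yn by (intro mult_right_mono) auto
  then have "(y\<^sup>2)\<^sup>2 \<le> (real d)\<^sup>2" using dn by (simp flip: power_mult)
  then have dy: "y\<^sup>2 \<le> d" by (rule power2_le_imp_le) simp
  then have d: "0 < real d" using y2 by linarith
  have r: "real r \<le> 2 * y\<^sup>2" using y2 unfolding r_def by linarith
  define c where "c = (real d)\<^sup>2 / n"
  have c: "y ^ 4 \<le> c" using dn n by (simp add: c_def field_simps)
  have "y\<^sup>2 * y\<^sup>2 \<le> c" using c by (simp add: power4_eq_xxxx power2_eq_square mult.assoc)
  moreover have "0 < y\<^sup>2" using y by simp
  ultimately have "y\<^sup>2 \<le> c / y\<^sup>2" by (simp only: pos_le_divide_eq)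
  then have yc: "2 * y\<^sup>2 \<le> 2 / y\<^sup>2 * c" by simp
  have t: "(1 + 1 / y) * c \<le> t"
    unfolding t_def c_def by (simp add: of_nat_nat) linarith
  have tr: "c * (1 + 1 / y - 2 / y\<^sup>2) \<le> real t - real r"
    using t r yc by (simp add: algebra_simps)
  have "2 / y\<^sup>2 \<le> 1" using y2 y by (simp add: pos_divide_le_eq)
  moreover have "0 \<le> 1 / y" using y by simp
  ultimately have "0 \<le> 1 + 1 / y - 2 / y\<^sup>2" by linarith
  moreover have "0 \<le> c" by (simp add: c_def)
  ultimately have "0 \<le> real t - real r" using tr by (meson mult_nonneg_nonneg order.trans)
  then show "r \<le> t" by simp
  have tr': "c * (1 + 1 / y - 2 / y\<^sup>2) \<le> real (t - r)"
    using tr \<open>r \<le> t\<close> by (simp add: of_nat_diff)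
  have "y\<^sup>2 * (real d * d) \<le> real n * d" using mult_right_mono[OF yd, of d] by (simp add: mult_ac)
  moreover have "y\<^sup>2 * d \<le> real n * d" using yn by (intro mult_right_mono) auto
  moreover have "y\<^sup>2 * real r \<le> y\<^sup>2 * (2 * d)" using r dy by (intro mult_left_mono) auto
  \<comment> \<open>The constant 12 is 2 + 2 + 8, from 2 * d^2, 2 * d and 4 * r <= 8 * d.\<close>
  ultimately have "y\<^sup>2 * (2 * real d * (real d + 1) + 4 * real r) \<le> 12 * (real n * d)"
    by (simp add: algebra_simps)
  then have "2 * real d * (real d + 1) + 4 * real r \<le> 12 / y\<^sup>2 * (real n * d)"
    using y by (simp add: pos_le_divide_eq mult.commute)
  then have "real n * d * (1 - 12 / y\<^sup>2) \<le> real (n * d) - real (2 * d * (d + 1)) - real (4 * r)"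
    by (simp add: algebra_simps)
  also have "\<dots> \<le> real (n * d - 2 * d * (d + 1) - 4 * r)" by linarith
  finally have s: "real n * d * (1 - 12 / y\<^sup>2) \<le> real (n * d - 2 * d * (d + 1) - 4 * r)" .
  have "12 / y\<^sup>2 \<le> 1" using y2 y by (simp add: pos_divide_le_eq)
  then have s2: "(real n * d * (1 - 12 / y\<^sup>2))\<^sup>2 \<le> (real (n * d - 2 * d * (d + 1) - 4 * r))\<^sup>2"
    by (intro power_mono s) auto
  have "(1 + 1 / (2 * y)) * (real n * real d ^ 4)
      \<le> (1 - 12 / y\<^sup>2)\<^sup>2 * (1 + 1 / y - 2 / y\<^sup>2) * (real n * real d ^ 4)"
    using est by (intro mult_right_mono) auto
  also have "\<dots> = c * (1 + 1 / y - 2 / y\<^sup>2) * (real n * d * (1 - 12 / y\<^sup>2))\<^sup>2"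
    using n by (simp add: c_def power_mult_distrib power2_eq_square power4_eq_xxxx)
  also have "\<dots> \<le> real (t - r) * (real (n * d - 2 * d * (d + 1) - 4 * r))\<^sup>2"
    using tr' s2 by (intro mult_mono) auto
  finally show "real n * real d ^ 4 \<le> 1 / (1 + 1 / (2 * y)) *
      (real (t - r) * (real (n * d - 2 * d * (d + 1) - 4 * r))\<^sup>2)"
    using y by (simp add: pos_le_divide_eq add_pos_pos mult_ac)
qed

text \<open>Since ln (4/3) >= 1/4, the power (4/3)^K is at least n^(9/4), which exceeds n^2.\<close>

lemma four_thirds_power_gt:
  fixes n K :: nat
  assumes "2 \<le> n" "9 * ln (real n) \<le> real K"
  shows "n\<^sup>2 * 3 ^ K < (4::nat) ^ K"
proof -
  have "exp (1 / 4 :: real) \<le> 4 / 3"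
    using exp_ge_add_one_self[of "- 1 / 4 :: real"] by (simp add: exp_minus field_simps)
  have "0 < ln (real n)" using assms by simp
  have "(real n)\<^sup>2 = exp (2 * ln (real n))"
    using assms(1) by (simp add: exp_double)
  also have "\<dots> < exp (real K * (1 / 4))"
    using assms(2) \<open>0 < ln (real n)\<close> by (simp add: field_simps)
  also have "\<dots> = exp (1 / 4) ^ K" by (rule exp_of_nat_mult)
  also have "\<dots> \<le> (4 / 3) ^ K"
    using \<open>exp (1 / 4 :: real) \<le> 4 / 3\<close> by (intro power_mono) auto
  finally have "(real n)\<^sup>2 * 3 ^ K < 4 ^ K" by (simp add: power_divide field_simps)
  then have "real (n\<^sup>2 * 3 ^ K) < real (4 ^ K)" by simp
  then show ?thesis by (simp only: of_nat_less_iff)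
qed

section \<open>The inequality for graphs with small codegrees, and its probability\<close>

lemma mobility_le_chromatic_number:
  fixes n d :: nat and y :: real
  assumes E: "E \<in> regular_rels n d"
    and small: "\<not> large_codegree n (nat \<lfloor>(1 + 1 / y) * (real d)\<^sup>2 / n\<rfloor> + 1) E"
    and y: "4 \<le> y" and n: "2 \<le> n" and yd: "y\<^sup>2 * d \<le> n" and dy: "y\<^sup>2 \<le> d"
    and log: "9 * ln (real n) + 2 \<le> y / 2"
  defines "G \<equiv> \<lparr> pverts = {..<n}, parcs = E \<rparr>"
  shows "mobility G \<le> enat (chromatic_number G)"
proof -
  have y2: "16 \<le> y\<^sup>2" using power_mono[OF y, of 2] by simp
  have d: "0 < d" using dy y2 by (intro Nat.gr0I) auto
  define t where "t = nat \<lfloor>(1 + 1 / y) * (real d)\<^sup>2 / n\<rfloor>"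
  have codeg: "card (E `` {w} \<inter> E `` {u}) \<le> t" if "w < n" "u < n" "w \<noteq> u" for w u
    using small that by (fastforce simp: large_codegree_def t_def)
  have "0 \<le> (1 + 1 / y) * (real d)\<^sup>2 / n" using y by simp
  then have t: "real t \<le> (1 + 1 / y) * (real d)\<^sup>2 / n"
    unfolding t_def by linarith
  \<comment> \<open>As d is at most n / 16, the codegree bound t, which is at most 2 * d^2 / n, is
    below d / 2. Separating colours need this.\<close>
  have "16 * real d \<le> y\<^sup>2 * d" using y2 by (intro mult_right_mono) auto
  then have "16 * real d \<le> n" using yd by linarith
  then have "16 * (real d * d) \<le> n * real d"
    using mult_right_mono[of "16 * real d" n "real d"] by (simp add: mult_ac)
  then have dd: "16 * ((real d)\<^sup>2 / n) \<le> d" using n by (simp add: field_simps power2_eq_square)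
  have "(1 + 1 / y) * ((real d)\<^sup>2 / n) \<le> 2 * ((real d)\<^sup>2 / n)"
    using y by (intro mult_right_mono) auto
  then have "2 * real t \<le> d" using t dd by simp
  then have half: "2 * t \<le> d" by linarith
  have codeg2: "2 * card (E `` {w} \<inter> E `` {u}) \<le> d" if "w < n" "u < n" "w \<noteq> u" for w u
    using codeg[OF that] half by linarith
  define k where "k = chromatic_number G"
  \<comment> \<open>Both alternatives give k >= y / 2: the first since \<epsilon> = 1 / y, the
    second since y^2 <= d.\<close>
  have "1 \<le> 2 * (1 / y) * k \<or> real d \<le> 2 * (real k)\<^sup>2"
    by (rule chromatic_number_lower_bound[OF E d _ codeg t]) (use n y in \<open>auto simp: k_def G_def\<close>)
  then have ky: "y / 2 \<le> k"
  proof
    assume "1 \<le> 2 * (1 / y) * k"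
    then show ?thesis using y by (simp add: field_simps)
  next
    assume "real d \<le> 2 * (real k)\<^sup>2"
    then have "y\<^sup>2 \<le> 4 * (real k)\<^sup>2" using dy zero_le_power2[of "real k"] by linarith
    then have "(y / 2)\<^sup>2 \<le> (real k)\<^sup>2" by (simp add: power_divide)
    then show ?thesis by (rule power2_le_imp_le) simp
  qed
  define K where "K = nat \<lceil>9 * ln (real n)\<rceil>"
  have "0 < ln (real n)" using n by simp
  then have K: "9 * ln (real n) \<le> K" "real K < 9 * ln (real n) + 1" "0 < K"
    unfolding K_def by linarith+
  have "real K + 1 < k" using K ky log by linarith
  then have Kk: "K + 1 < k" by linarith
  have "D \<le> k" if "mobile D G" for D
  proof (rule ccontr)
    assume "\<not> D \<le> k"
    then have "\<not> mobile D G"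
      unfolding G_def using Kk K(3) n
      by (intro not_mobile_if_small_codegree[OF E d codeg2 four_thirds_power_gt[OF n K(1)]]) auto
    then show False using that by simp
  qed
  then show ?thesis unfolding mobility_def k_def by (auto intro!: Sup_least)
qed

text \<open>Every graph violating the inequality has a large codegree, so the tail bound applies. As
  q <= 1 and r >= y^2, the exponent r may be replaced by y^2.\<close>

lemma prob_mobility_le_chromatic_number:
  fixes n d :: nat and y :: real
  assumes y: "4 \<le> y" and n: "2 \<le> n" and yn: "y\<^sup>2 \<le> n" and yd: "y\<^sup>2 * d \<le> n"
    and dn: "n * y ^ 4 \<le> (real d)\<^sup>2" and dy: "y\<^sup>2 \<le> d"
    and est: "1 + 1 / (2 * y) \<le> (1 - 12 / y\<^sup>2)\<^sup>2 * (1 + 1 / y - 2 / y\<^sup>2)"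
    and log: "9 * ln (real n) + 2 \<le> y / 2"
    and even: "even (n * d)"
  shows "1 - (real n)\<^sup>2 * (1 / (1 + 1 / (2 * y))) powr (y\<^sup>2)
    \<le> measure_pmf.prob (random_regular_graph n d) {G. mobility G \<le> enat (chromatic_number G)}"
proof -
  let ?Q = "regular_rels n d" and ?g = "\<lambda>E. \<lparr> pverts = {..<n}, parcs = E \<rparr>"
  define q where "q = 1 / (1 + 1 / (2 * y))"
  define r where "r = nat \<lceil>y\<^sup>2\<rceil>"
  define t where "t = nat \<lfloor>(1 + 1 / y) * (real d)\<^sup>2 / n\<rfloor> + 1"
  have q: "0 < q" "q \<le> 1" using y by (auto simp: q_def field_simps add_pos_pos)
  have y2: "16 \<le> y\<^sup>2" using power_mono[OF y, of 2] by simp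
  have d: "0 < d" using dy y2 by (intro Nat.gr0I) auto
  have "16 * real d \<le> y\<^sup>2 * d" using y2 by (intro mult_right_mono) auto
  then have "d < n" using yd d by linarith
  then have ne: "?Q \<noteq> {}" using even by (rule regular_rels_nonempty)
  have fin: "finite ?Q" by (rule finite_regular_rels)
  have cardQ: "0 < card ?Q" using ne fin by (simp add: card_gt_0_iff)
  have inj: "inj_on ?g A" for A by (auto simp: inj_on_def)
  define S where "S = {E \<in> ?Q. mobility (?g E) \<le> enat (chromatic_number (?g E))}"
  have "real (card {E \<in> ?Q. large_codegree n t E}) \<le> (real n)\<^sup>2 * q ^ r * card ?Q"
    unfolding q_def r_def t_def
    by (intro card_large_codegree_le_power switching_ratio_bound y yn yd dn est d) (use n in auto)
  also have "q ^ r \<le> q powr (y\<^sup>2)"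
  proof -
    have "q ^ r = q powr (real r)" using q by (simp add: powr_realpow)
    also have "\<dots> \<le> q powr (y\<^sup>2)"
      using q by (intro powr_mono') (auto simp: r_def)
    finally show ?thesis .
  qed
  finally have bad: "real (card {E \<in> ?Q. large_codegree n t E})
      \<le> (real n)\<^sup>2 * q powr (y\<^sup>2) * card ?Q"
    by (simp add: mult_left_mono mult_right_mono)
  have "?Q - S \<subseteq> {E \<in> ?Q. large_codegree n t E}"
    using mobility_le_chromatic_number[OF _ _ y n yd dy log] by (auto simp: S_def t_def)
  then have "card (?Q - S) \<le> card {E \<in> ?Q. large_codegree n t E}"
    using fin by (intro card_mono) auto
  moreover have "card (?Q - S) = card ?Q - card S"
    using fin by (intro card_Diff_subset) (auto simp: S_def)
  moreover have "card S \<le> card ?Q" using fin by (intro card_mono) (auto simp: S_def)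
  ultimately have "real (card ?Q) - card S \<le> (real n)\<^sup>2 * q powr (y\<^sup>2) * card ?Q"
    using bad by linarith
  then have *: "1 - (real n)\<^sup>2 * q powr (y\<^sup>2) \<le> real (card S) / card ?Q"
    using cardQ by (simp add: field_simps)
  have "measure_pmf.prob (random_regular_graph n d) {G. mobility G \<le> enat (chromatic_number G)}
      = real (card (regular_graphs n d \<inter> {G. mobility G \<le> enat (chromatic_number G)}))
        / card (regular_graphs n d)"
    unfolding random_regular_graph_def
    using ne finite_regular_graphs by (intro measure_pmf_of_set) (auto simp: regular_graphs_eq_image)
  also have "regular_graphs n d \<inter> {G. mobility G \<le> enat (chromatic_number G)} = ?g ` S"
    by (auto simp: regular_graphs_eq_image S_def)
  finally show ?thesis
    using * by (simp add: regular_graphs_eq_image card_image[OF inj] q_def)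
qed

theorem theorem6p4:
  fixes \<alpha> :: real and d :: "nat \<Rightarrow> nat"
  assumes "0 < \<alpha>" and "\<alpha> < 1/4"
    and "\<forall>\<^sub>F n in sequentially.
           real n powr (1/2 + \<alpha>) < real (d n) \<and> real (d n) < real n powr (1 - \<alpha>)"
  shows "asymp_almost_surely_regular d (\<lambda>G. mobility G \<le> enat (chromatic_number G))"
proof -
  \<comment> \<open>With y^2 = n^\<alpha>, the upper bound on d gives y^2 * d <= n and the lower
    bound gives n * y^4 = n^(1 + 2 * \<alpha>) <= d^2.\<close>
  define y where "y n = real n powr (\<alpha> / 2)" for n
  define b where "b n = (real n)\<^sup>2 * (1 / (1 + 1 / (2 * y n))) powr ((y n)\<^sup>2)" for n
  let ?p = "\<lambda>n. measure_pmf.prob (random_regular_graph n (d n))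
    {G. mobility G \<le> enat (chromatic_number G)}"
  let ?F = "inf sequentially (principal {n. even (n * d n)})"
  have y_top: "filterlim y at_top sequentially"
    unfolding y_def using assms(1) by real_asymp
  \<comment> \<open>The power is roughly exp (- y / 2) with y = n^(\<alpha> / 2), which outweighs
    the factor n^2 of the union bound.\<close>
  have b0: "b \<longlonglongrightarrow> 0"
    unfolding b_def y_def using assms(1) by real_asymp
  have "\<forall>\<^sub>F x :: real in at_top. 1 + 1 / (2 * x) \<le> (1 - 12 / x\<^sup>2)\<^sup>2 * (1 + 1 / x - 2 / x\<^sup>2)"
    by real_asymp
  then have est: "\<forall>\<^sub>F n in sequentially.
      1 + 1 / (2 * y n) \<le> (1 - 12 / (y n)\<^sup>2)\<^sup>2 * (1 + 1 / y n - 2 / (y n)\<^sup>2)"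
    using y_top by (rule eventually_compose_filterlim)
  have log: "\<forall>\<^sub>F n in sequentially. 9 * ln (real n) + 2 \<le> y n / 2"
    unfolding y_def using assms(1) by real_asymp
  have y4: "\<forall>\<^sub>F n in sequentially. 4 \<le> y n"
    using y_top by (auto simp: filterlim_at_top)
  have lower: "\<forall>\<^sub>F n in sequentially. even (n * d n) \<longrightarrow> 1 - b n \<le> ?p n"
    using est log y4 assms(3) eventually_ge_at_top[of 2]
  proof eventually_elim
    case (elim n)
    have n: "1 \<le> real n" "0 < real n" using elim by auto
    have y2: "(y n)\<^sup>2 = real n powr \<alpha>"
      using n by (simp add: y_def power2_eq_square flip: powr_add)
    have "real n powr \<alpha> \<le> real n powr 1" using n assms by (intro powr_mono) auto
    then have yn: "(y n)\<^sup>2 \<le> n" using n by (simp add: y2)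
    have "(y n)\<^sup>2 * d n \<le> real n powr \<alpha> * real n powr (1 - \<alpha>)"
      unfolding y2 using elim by (intro mult_left_mono) auto
    also have "\<dots> = n" using n by (simp flip: powr_add)
    finally have yd: "(y n)\<^sup>2 * d n \<le> n" .
    have "n * (y n) ^ 4 = real n powr 1 * (real n powr \<alpha> * real n powr \<alpha>)"
      using n by (simp flip: y2 add: power4_eq_xxxx power2_eq_square)
    also have "\<dots> = real n powr (1/2 + \<alpha>) * real n powr (1/2 + \<alpha>)"
      by (simp only: powr_add[symmetric]) (simp add: algebra_simps)
    also have "\<dots> \<le> real (d n) * real (d n)" using elim by (intro mult_mono) auto
    finally have dn: "n * (y n) ^ 4 \<le> (real (d n))\<^sup>2" by (simp add: power2_eq_square)
    have "real n powr \<alpha> \<le> real n powr (1/2 + \<alpha>)" using n by (intro powr_mono) auto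
    also have "\<dots> \<le> d n" using elim by simp
    finally have dy: "(y n)\<^sup>2 \<le> d n" by (simp add: y2)
    show ?case
      unfolding b_def
      using prob_mobility_le_chromatic_number[OF _ _ yn yd dn dy] elim by simp
  qed
  have "((\<lambda>n. 1 - b n) \<longlongrightarrow> 1 - 0) sequentially" by (intro tendsto_intros b0)
  then have "((\<lambda>n. 1 - b n) \<longlongrightarrow> 1) ?F" by (auto intro: tendsto_mono[of _ sequentially])
  then have "(?p \<longlongrightarrow> 1) ?F"
  proof (rule tendsto_sandwich[rotated 2])
    show "\<forall>\<^sub>F n in ?F. 1 - b n \<le> ?p n"
      using lower by (simp add: eventually_inf_principal)
    show "\<forall>\<^sub>F n in ?F. ?p n \<le> 1" by simp
  qed simp
  then show ?thesis by (simp add: asymp_almost_surely_regular_def)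
qed

end
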